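(* Let $m\ge1$ and let $S$ be any cubical-like generating set of $G=H_{2m+1}(\mathbb{Z})$. The complete growth series of $(G,S)$ is not $\mathbb{N}G$-rational.
   Context: Let $H_3(\mathbb{Z})=\langle x,y\mid[x,y]\text{ central}\rangle$ and $z=[x,y]$. The group $H_{2m+1}(\mathbb{Z})$ is the centrally amalgamated direct product of $m$ copies $G_1,\dots,G_m$ of $H_3(\mathbb{Z})$ along the common center $Z=\langle z\rangle$, i.e. the quotient of $\prod_{i=1}^mG_i$ by the subgroup generated by all $\iota_i(c)\iota_j(c)^{-1}$, $c\in Z$, where $\iota_i\colon Z\hookrightarrow G_i$ identifies $Z$ with the center of $G_i$. A cubical-like generating set of $H_{2m+1}(\mathbb{Z})$ is the image of a set $\prod_{i=1}^m(S_i\cup\{e\})$, where each $S_i$ is a finite symmetric generating set of $G_i$. For a group $G$ with finite symmetric generating set $S$, $\|g\|_S$ denotes the word length of $g\in G$. $\mathbb{N}G$ is the group semiring (finite formal sums of elements of $G$ with coefficients in $\mathbb{N}=\{0,1,2,\dots\}$), and $\mathbb{N}G[[s]]$ is the semiring of formal power series over it, the variable $s$ commuting with coefficients. The complete growth series of $(G,S)$ is $\sum_{n\ge 0}\big(\sum_{\|g\|_S=n} g\big)s^n\in\mathbb{N}G[[s]]$. A series in $\mathbb{N}G[[s]]$ is proper if its constant coefficient is $0$. A proper linear system over $\mathbb{N}G[s]$ is a finite system of equations $X_i=P_i(X_1,\dots,X_n)$, $i=1,\dots,n$, where each $P_i$ is a finite sum of monomials of the form $r\cdot s^k$ or $rX_j\cdot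 s^k$ with $r\in\mathbb{N}G$, $1\le j\le n$ and $k\ge 1$; such a system has a unique solution $(F_1,\dots,F_n)$ consisting of proper series. A series $F=\sum_{n\ge0}a_ns^n\in\mathbb{N}G[[s]]$ is $\mathbb{N}G$-rational if $\sum_{n\ge1}a_ns^n$ is the first component of the proper solution of some proper linear system over $\mathbb{N}G[s]$. *)

theory Defs
  imports
    "HOL-Library.Poly_Mapping"
    "HOL-Computational_Algebra.Formal_Power_Series"
    "HOL-Algebra.Coset"
    "HOL-Algebra.Generated_Groups"
    "HOL-Algebra.Product_Groups"
begin

section \<open>Groups given by generators and relators\<close>

text \<open>A letter \<open>(g, True)\<close> stands for the generator \<open>g\<close> and \<open>(g, False)\<close> for its inverse.\<close>

type_synonym 'g word = "('g \<times> bool) list"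

definition inv_word :: "'g word \<Rightarrow> 'g word" where
  "inv_word w = rev (map (\<lambda>(g, b). (g, \<not> b)) w)"

definition comm_word :: "'g word \<Rightarrow> 'g word \<Rightarrow> 'g word" where
  "comm_word u v = u @ v @ inv_word u @ inv_word v"

inductive pres_eq :: "'g word set \<Rightarrow> 'g word \<Rightarrow> 'g word \<Rightarrow> bool" for R where
  refl: "pres_eq R w w"
| sym: "pres_eq R u v \<Longrightarrow> pres_eq R v u"
| trans: "pres_eq R u v \<Longrightarrow> pres_eq R v w \<Longrightarrow> pres_eq R u w"
| cancel: "pres_eq R (u @ [(g, b), (g, \<not> b)] @ v) (u @ v)"
| relator: "r \<in> R \<Longrightarrow> pres_eq R (u @ r @ v) (u @ v)"

definition pres_rel :: "'g word set \<Rightarrow> ('g word \<times> 'g word) set" where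
  "pres_rel R = {(u, v). pres_eq R u v}"

definition word_class :: "'g word set \<Rightarrow> 'g word \<Rightarrow> 'g word set" where
  "word_class R w = pres_rel R `` {w}"

definition presented_group :: "'g word set \<Rightarrow> 'g word set monoid" where
  "presented_group R =
     \<lparr>carrier = UNIV // pres_rel R,
      mult = (\<lambda>A B. \<Union>u\<in>A. \<Union>v\<in>B. word_class R (u @ v)),
      one = word_class R []\<rparr>"

lemma equiv_pres_rel: "equiv UNIV (pres_rel R)"
  unfolding pres_rel_def
  by (intro equivI refl_onI symI transI; clarsimp)
    (rule pres_eq.refl, erule pres_eq.sym, erule (1) pres_eq.trans)

lemma word_class_eq_iff: "word_class R u = word_class R v \<longleftrightarrow> pres_eq R u v"
  using eq_equiv_class_iff[OF equiv_pres_rel, of u v R]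
  by (simp add: word_class_def pres_rel_def)

lemma pres_eq_context: "pres_eq R u v \<Longrightarrow> pres_eq R (a @ u @ b) (a @ v @ b)"
proof (induction rule: pres_eq.induct)
  case (cancel u g c v)
  show ?case using pres_eq.cancel[of R "a @ u" g c "v @ b"] by simp
next
  case (relator r u v)
  then show ?case using pres_eq.relator[of r R "a @ u" "v @ b"] by simp
next
  case (refl w)
  show ?case by (rule pres_eq.refl)
next
  case (sym u v)
  from sym.IH show ?case by (rule pres_eq.sym)
next
  case (trans u v w)
  from trans.IH show ?case by (rule pres_eq.trans)
qed

lemma pres_eq_append:
  assumes "pres_eq R u u'" "pres_eq R v v'"
  shows "pres_eq R (u @ v) (u' @ v')"
proof (rule pres_eq.trans)
  show "pres_eq R (u @ v) (u' @ v)" using pres_eq_context[OF assms(1), of "[]" v] by simp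
  show "pres_eq R (u' @ v) (u' @ v')" using pres_eq_context[OF assms(2), of u' "[]"] by simp
qed

lemma mult_word_class:
  "word_class R u \<otimes>\<^bsub>presented_group R\<^esub> word_class R v = word_class R (u @ v)"
proof -
  have *: "word_class R (u' @ v') = word_class R (u @ v)"
    if "u' \<in> word_class R u" "v' \<in> word_class R v" for u' v'
  proof -
    have "pres_eq R u u'" "pres_eq R v v'"
      using that by (simp_all add: word_class_def pres_rel_def)
    then show ?thesis
      unfolding word_class_eq_iff by (rule pres_eq.sym[OF pres_eq_append])
  qed
  have mem: "w \<in> word_class R w" for w
    by (simp add: word_class_def pres_rel_def pres_eq.refl)
  have "(\<Union>u'\<in>word_class R u. \<Union>v'\<in>word_class R v. word_class R (u' @ v')) = word_class R (u @ v)"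
    using * mem by blast
  then show ?thesis by (simp add: presented_group_def)
qed

lemma carrier_presented_group: "carrier (presented_group R) = range (word_class R)"
  by (auto simp: presented_group_def word_class_def quotient_def)

lemma one_presented_group: "\<one>\<^bsub>presented_group R\<^esub> = word_class R []"
  by (simp add: presented_group_def)

lemma pres_eq_inv_word: "pres_eq R (inv_word w @ w) []"
proof (induction w)
  case Nil
  show ?case by (simp add: inv_word_def pres_eq.refl)
next
  case (Cons l w)
  obtain g b where l: "l = (g, b)" by (cases l)
  have "inv_word (l # w) @ (l # w) = inv_word w @ [(g, \<not> b), (g, \<not> \<not> b)] @ w"
    by (simp add: inv_word_def l)
  then show ?case using pres_eq.cancel[of R "inv_word w" g "\<not> b" w] Cons
    by (metis pres_eq.trans)
qed

lemma group_presented_group: "group (presented_group R)"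
proof (rule groupI)
  fix x assume "x \<in> carrier (presented_group R)"
  then obtain w where w: "x = word_class R w" by (auto simp: carrier_presented_group)
  have "word_class R (inv_word w) \<otimes>\<^bsub>presented_group R\<^esub> x = \<one>\<^bsub>presented_group R\<^esub>"
    by (simp add: w mult_word_class one_presented_group word_class_eq_iff pres_eq_inv_word)
  then show "\<exists>y\<in>carrier (presented_group R). y \<otimes>\<^bsub>presented_group R\<^esub> x = \<one>\<^bsub>presented_group R\<^esub>"
    by (auto simp: carrier_presented_group)
qed (auto simp: carrier_presented_group one_presented_group mult_word_class)


section \<open>Heisenberg groups\<close>

datatype heis_gen = Gen_x | Gen_y

definition heis_z_word :: "heis_gen word" where
  "heis_z_word = comm_word [(Gen_x, True)] [(Gen_y, True)]"

text \<open>The relators say that \<open>[x, y]\<close> commutes with every word.\<close>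

definition heis_relators :: "heis_gen word set" where
  "heis_relators = {comm_word heis_z_word w | w. True}"

definition H3 :: "heis_gen word set monoid" where
  "H3 = presented_group heis_relators"

definition heis_z :: "heis_gen word set" where
  "heis_z = word_class heis_relators heis_z_word"

definition heis_Z :: "heis_gen word set set" where
  "heis_Z = generate H3 {heis_z}"

abbreviation H3_power :: "nat \<Rightarrow> (nat \<Rightarrow> heis_gen word set) monoid" where
  "H3_power m \<equiv> product_group {1..m} (\<lambda>_. H3)"

definition heis_iota :: "nat \<Rightarrow> nat \<Rightarrow> heis_gen word set \<Rightarrow> nat \<Rightarrow> heis_gen word set" where
  "heis_iota m i c = (\<lambda>k\<in>{1..m}. if k = i then c else \<one>\<^bsub>H3\<^esub>)"

definition amalg_subgroup :: "nat \<Rightarrow> (nat \<Rightarrow> heis_gen word set) set" where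
  "amalg_subgroup m = generate (H3_power m)
     {heis_iota m i c \<otimes>\<^bsub>H3_power m\<^esub> inv\<^bsub>H3_power m\<^esub> heis_iota m j c | i j c.
        i \<in> {1..m} \<and> j \<in> {1..m} \<and> c \<in> heis_Z}"

text \<open>\<open>heisenberg m\<close> is the group usually written \<open>H\<close> with index \<open>2 * m + 1\<close>.\<close>

definition heisenberg :: "nat \<Rightarrow> (nat \<Rightarrow> heis_gen word set) set monoid" where
  "heisenberg m = H3_power m Mod amalg_subgroup m"

definition heis_proj ::
    "nat \<Rightarrow> (nat \<Rightarrow> heis_gen word set) \<Rightarrow> (nat \<Rightarrow> heis_gen word set) set" where
  "heis_proj m f = amalg_subgroup m #>\<^bsub>H3_power m\<^esub> f"

lemma group_H3: "group H3"
  by (simp add: H3_def group_presented_group)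

lemma heis_z_in_carrier: "heis_z \<in> carrier H3"
  by (auto simp: heis_z_def H3_def carrier_presented_group)

lemma heis_z_commutes:
  assumes "g \<in> carrier H3"
  shows "heis_z \<otimes>\<^bsub>H3\<^esub> g = g \<otimes>\<^bsub>H3\<^esub> heis_z"
proof -
  let ?R = heis_relators and ?z = heis_z_word
  obtain w where w: "g = word_class ?R w"
    using assms by (auto simp: H3_def carrier_presented_group)
  let ?r = "comm_word ?z w"
  have "?r \<in> ?R" by (auto simp: heis_relators_def)
  then have 1: "pres_eq ?R (?r @ w @ ?z) (w @ ?z)"
    using pres_eq.relator[of ?r ?R "[]" "w @ ?z"] by simp
  have 2: "pres_eq ?R (?r @ w @ ?z) (?z @ w @ inv_word ?z @ ?z)"
    using pres_eq_context[OF pres_eq_inv_word[of ?R w], of "?z @ w @ inv_word ?z" ?z]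
    by (simp add: comm_word_def)
  have 3: "pres_eq ?R (?z @ w @ inv_word ?z @ ?z) (?z @ w)"
    using pres_eq_context[OF pres_eq_inv_word[of ?R ?z], of "?z @ w" "[]"] by simp
  have "pres_eq ?R (?z @ w) (w @ ?z)"
    using 1 2 3 by (meson pres_eq.sym pres_eq.trans)
  then show ?thesis
    by (simp add: heis_z_def H3_def w mult_word_class word_class_eq_iff)
qed

lemma heis_Z_subset: "heis_Z \<subseteq> carrier H3"
  unfolding heis_Z_def
  by (rule group.generate_incl[OF group_H3]) (simp add: heis_z_in_carrier)

lemma heis_Z_commutes:
  assumes "c \<in> heis_Z" "g \<in> carrier H3"
  shows "c \<otimes>\<^bsub>H3\<^esub> g = g \<otimes>\<^bsub>H3\<^esub> c"
proof -
  interpret group H3 by (rule group_H3)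
  have sub: "generate H3 {heis_z} \<subseteq> carrier H3" using heis_Z_subset by (simp add: heis_Z_def)
  from assms(1)[unfolded heis_Z_def] show ?thesis
  proof (induction rule: generate.induct)
    case one
    show ?case using assms(2) by simp
  next
    case (incl h)
    then show ?case using heis_z_commutes[OF assms(2)] by simp
  next
    case (inv h)
    then have h: "h = heis_z" by simp
    let ?z = heis_z
    have z: "?z \<in> carrier H3" by (rule heis_z_in_carrier)
    have "inv\<^bsub>H3\<^esub> ?z \<otimes>\<^bsub>H3\<^esub> g =
        inv\<^bsub>H3\<^esub> ?z \<otimes>\<^bsub>H3\<^esub> (g \<otimes>\<^bsub>H3\<^esub> ?z) \<otimes>\<^bsub>H3\<^esub> inv\<^bsub>H3\<^esub> ?z"
      using z assms(2) by (simp add: m_assoc)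
    also have "\<dots> = inv\<^bsub>H3\<^esub> ?z \<otimes>\<^bsub>H3\<^esub> (?z \<otimes>\<^bsub>H3\<^esub> g) \<otimes>\<^bsub>H3\<^esub> inv\<^bsub>H3\<^esub> ?z"
      by (simp only: heis_z_commutes[OF assms(2)])
    also have "\<dots> = g \<otimes>\<^bsub>H3\<^esub> inv\<^bsub>H3\<^esub> ?z"
      using z assms(2) by (simp add: m_assoc[symmetric])
    finally show ?case by (simp only: h)
  next
    case (eng h1 h2)
    then have h: "h1 \<in> carrier H3" "h2 \<in> carrier H3" using sub by auto
    have "h1 \<otimes>\<^bsub>H3\<^esub> h2 \<otimes>\<^bsub>H3\<^esub> g = h1 \<otimes>\<^bsub>H3\<^esub> (g \<otimes>\<^bsub>H3\<^esub> h2)"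
      by (simp only: m_assoc[OF h assms(2)] eng.IH)
    also have "\<dots> = g \<otimes>\<^bsub>H3\<^esub> h1 \<otimes>\<^bsub>H3\<^esub> h2"
      by (simp only: m_assoc[OF h(1) assms(2) h(2), symmetric] eng.IH)
    finally show ?case by (simp only: m_assoc[OF assms(2) h])
  qed
qed

lemma group_H3_power: "group (H3_power m)"
  by (simp add: group_H3)

lemma amalg_subgroup_normal: "amalg_subgroup m \<lhd> H3_power m"
proof -
  interpret P: group "H3_power m" by (rule group_H3_power)
  interpret H: group H3 by (rule group_H3)
  let ?I = "{1..m}"
  let ?K = "{heis_iota m i c \<otimes>\<^bsub>H3_power m\<^esub> inv\<^bsub>H3_power m\<^esub> heis_iota m j c | i j c.
        i \<in> ?I \<and> j \<in> ?I \<and> c \<in> heis_Z}"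
  have iota: "heis_iota m i c \<in> carrier (H3_power m)" if "c \<in> heis_Z" for i c
    using that heis_Z_subset by (auto simp: heis_iota_def PiE_iff)
  have central: "heis_iota m i c \<otimes>\<^bsub>H3_power m\<^esub> g = g \<otimes>\<^bsub>H3_power m\<^esub> heis_iota m i c"
    if "c \<in> heis_Z" "g \<in> carrier (H3_power m)" for i c g
    using that heis_Z_commutes[OF that(1)]
    by (intro ext) (auto simp: heis_iota_def PiE_iff)
  have sub: "?K \<subseteq> carrier (H3_power m)" using iota by (force intro: P.m_closed P.inv_closed)
  show ?thesis unfolding amalg_subgroup_def
  proof (rule P.normal_generateI[OF sub])
    fix h g assume "h \<in> ?K" and g: "g \<in> carrier (H3_power m)"
    then obtain i j c where ij: "i \<in> ?I" "j \<in> ?I" "c \<in> heis_Z"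
      and h: "h = heis_iota m i c \<otimes>\<^bsub>H3_power m\<^esub> inv\<^bsub>H3_power m\<^esub> heis_iota m j c" by blast
    let ?a = "heis_iota m i c" and ?b = "heis_iota m j c"
    have a: "?a \<in> carrier (H3_power m)" and b: "?b \<in> carrier (H3_power m)"
      using iota ij by auto
    have "g \<otimes>\<^bsub>H3_power m\<^esub> inv\<^bsub>H3_power m\<^esub> ?b = inv\<^bsub>H3_power m\<^esub> ?b \<otimes>\<^bsub>H3_power m\<^esub> g"
      using central[OF ij(3) g] a b g
      by (metis P.inv_closed P.inv_solve_left P.inv_solve_right P.m_assoc P.m_closed)
    then have gh: "g \<otimes>\<^bsub>H3_power m\<^esub> h = h \<otimes>\<^bsub>H3_power m\<^esub> g"
      using central[OF ij(3) g, of i] a b g unfolding h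
      by (metis P.inv_closed P.m_assoc)
    have "h \<in> carrier (H3_power m)" unfolding h by (intro P.m_closed P.inv_closed a b)
    then have "g \<otimes>\<^bsub>H3_power m\<^esub> h \<otimes>\<^bsub>H3_power m\<^esub> inv\<^bsub>H3_power m\<^esub> g = h"
      unfolding gh using g by (metis P.inv_solve_right P.m_closed)
    then show "g \<otimes>\<^bsub>H3_power m\<^esub> h \<otimes>\<^bsub>H3_power m\<^esub> inv\<^bsub>H3_power m\<^esub> g \<in> ?K"
      using \<open>h \<in> ?K\<close> by simp
  qed
qed

lemma group_heisenberg: "group (heisenberg m)"
  unfolding heisenberg_def
  by (rule normal.factorgroup_is_group[OF amalg_subgroup_normal])


section \<open>Generating sets and word length\<close>

definition finite_symmetric_generating_set :: "('a, 'b) monoid_scheme \<Rightarrow> 'a set \<Rightarrow> bool" where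
  "finite_symmetric_generating_set G S \<longleftrightarrow>
     finite S \<and> S \<subseteq> carrier G \<and> (\<forall>s\<in>S. inv\<^bsub>G\<^esub> s \<in> S) \<and> generate G S = carrier G"

definition cubical_like_generating_set ::
    "nat \<Rightarrow> (nat \<Rightarrow> heis_gen word set) set set \<Rightarrow> bool" where
  "cubical_like_generating_set m S \<longleftrightarrow>
     (\<exists>T. (\<forall>i\<in>{1..m}. finite_symmetric_generating_set H3 (T i)) \<and>
          S = heis_proj m ` (\<Pi>\<^sub>E i\<in>{1..m}. T i \<union> {\<one>\<^bsub>H3\<^esub>}))"

definition word_length :: "('a, 'b) monoid_scheme \<Rightarrow> 'a set \<Rightarrow> 'a \<Rightarrow> nat" where
  "word_length G S g =
     (LEAST n. \<exists>ws. length ws = n \<and> set ws \<subseteq> S \<and> foldr (\<otimes>\<^bsub>G\<^esub>) ws \<one>\<^bsub>G\<^esub> = g)"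


section \<open>The group semiring and power series over it\<close>

text \<open>
  A finite formal sum of elements of \<open>G\<close> with natural coefficients is a finitely supported
  function \<open>'a \<Rightarrow>\<^sub>0 nat\<close> with support in \<open>carrier G\<close>; a formal power series over these is
  an element of \<open>('a \<Rightarrow>\<^sub>0 nat) fps\<close>. Addition is the one of these types. The library
  products on \<open>\<Rightarrow>\<^sub>0\<close> and \<open>fps\<close> would need a type class multiplication on \<open>'a\<close>, so the
  products are defined here from the operation of \<open>G\<close>.
\<close>

definition group_semiring :: "('a, 'b) monoid_scheme \<Rightarrow> ('a \<Rightarrow>\<^sub>0 nat) set" where
  "group_semiring G = {r. Poly_Mapping.keys r \<subseteq> carrier G}"

definition gs_mult ::
    "('a, 'b) monoid_scheme \<Rightarrow> ('a \<Rightarrow>\<^sub>0 nat) \<Rightarrow> ('a \<Rightarrow>\<^sub>0 nat) \<Rightarrow> ('a \<Rightarrow>\<^sub>0 nat)" where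
  "gs_mult G p q =
     (\<Sum>g\<in>Poly_Mapping.keys p. \<Sum>h\<in>Poly_Mapping.keys q.
        Poly_Mapping.single (g \<otimes>\<^bsub>G\<^esub> h) (Poly_Mapping.lookup p g * Poly_Mapping.lookup q h))"

definition gs_series :: "('a, 'b) monoid_scheme \<Rightarrow> ('a \<Rightarrow>\<^sub>0 nat) fps set" where
  "gs_series G = {F. \<forall>n. fps_nth F n \<in> group_semiring G}"

definition gs_series_mult ::
    "('a, 'b) monoid_scheme \<Rightarrow> ('a \<Rightarrow>\<^sub>0 nat) fps \<Rightarrow> ('a \<Rightarrow>\<^sub>0 nat) fps \<Rightarrow> ('a \<Rightarrow>\<^sub>0 nat) fps" where
  "gs_series_mult G E F =
     Abs_fps (\<lambda>n. \<Sum>i=0..n. gs_mult G (fps_nth E i) (fps_nth F (n - i)))"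

definition coeff_monom :: "('a \<Rightarrow>\<^sub>0 nat) \<Rightarrow> nat \<Rightarrow> ('a \<Rightarrow>\<^sub>0 nat) fps" where
  "coeff_monom r k = Abs_fps (\<lambda>n. if n = k then r else 0)"

text \<open>The sum below is over a finite set whenever \<open>S\<close> is a finite generating set of \<open>G\<close>.\<close>

definition complete_growth_series ::
    "('a, 'b) monoid_scheme \<Rightarrow> 'a set \<Rightarrow> ('a \<Rightarrow>\<^sub>0 nat) fps" where
  "complete_growth_series G S =
     Abs_fps (\<lambda>n. \<Sum>g\<in>{g \<in> carrier G. word_length G S g = n}. Poly_Mapping.single g 1)"

lemma complete_growth_series_in_gs_series: "complete_growth_series G S \<in> gs_series G"
proof -
  have "Poly_Mapping.keys (\<Sum>g\<in>A. Poly_Mapping.single g (1::nat)) \<subseteq> carrier G"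
    if "A \<subseteq> carrier G" for A
    using Poly_Mapping.keys_sum[of "\<lambda>g. Poly_Mapping.single g (1::nat)" A] that by auto
  then show ?thesis
    by (simp add: complete_growth_series_def gs_series_def group_semiring_def)
qed


section \<open>Rational series\<close>

text \<open>
  \<open>ConstTerm r k\<close> encodes the monomial \<open>r s^k\<close> and \<open>VarTerm r j k\<close> the monomial
  \<open>r X_j s^k\<close>; a right-hand side \<open>P_i\<close> is the list of its monomials. As \<open>s\<close> commutes with
  coefficients, \<open>r X_j s^k\<close> evaluates to \<open>(r s^k) X_j\<close>.
\<close>

datatype 'r lin_term = ConstTerm 'r nat | VarTerm 'r nat nat

fun eval_term ::
    "('a, 'b) monoid_scheme \<Rightarrow> (nat \<Rightarrow> ('a \<Rightarrow>\<^sub>0 nat) fps) \<Rightarrow> ('a \<Rightarrow>\<^sub>0 nat) lin_term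
      \<Rightarrow> ('a \<Rightarrow>\<^sub>0 nat) fps" where
  "eval_term G F (ConstTerm r k) = coeff_monom r k"
| "eval_term G F (VarTerm r j k) = gs_series_mult G (coeff_monom r k) (F j)"

fun proper_term :: "('a, 'b) monoid_scheme \<Rightarrow> nat \<Rightarrow> ('a \<Rightarrow>\<^sub>0 nat) lin_term \<Rightarrow> bool" where
  "proper_term G n (ConstTerm r k) \<longleftrightarrow> r \<in> group_semiring G \<and> 1 \<le> k"
| "proper_term G n (VarTerm r j k) \<longleftrightarrow> r \<in> group_semiring G \<and> j \<in> {1..n} \<and> 1 \<le> k"

definition proper_linear_system ::
    "('a, 'b) monoid_scheme \<Rightarrow> nat \<Rightarrow> (nat \<Rightarrow> ('a \<Rightarrow>\<^sub>0 nat) lin_term list) \<Rightarrow> bool" where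
  "proper_linear_system G n P \<longleftrightarrow> (\<forall>i\<in>{1..n}. \<forall>t\<in>set (P i). proper_term G n t)"

definition proper_series :: "('a \<Rightarrow>\<^sub>0 nat) fps \<Rightarrow> bool" where
  "proper_series F \<longleftrightarrow> fps_nth F 0 = 0"

definition proper_solution ::
    "('a, 'b) monoid_scheme \<Rightarrow> nat \<Rightarrow> (nat \<Rightarrow> ('a \<Rightarrow>\<^sub>0 nat) lin_term list)
      \<Rightarrow> (nat \<Rightarrow> ('a \<Rightarrow>\<^sub>0 nat) fps) \<Rightarrow> bool" where
  "proper_solution G n P F \<longleftrightarrow>
     (\<forall>i\<in>{1..n}. F i \<in> gs_series G \<and> proper_series (F i) \<and>
        F i = sum_list (map (eval_term G F) (P i)))"

definition gs_rational :: "('a, 'b) monoid_scheme \<Rightarrow> ('a \<Rightarrow>\<^sub>0 nat) fps \<Rightarrow> bool" where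
  "gs_rational G A \<longleftrightarrow> A \<in> gs_series G \<and>
     (\<exists>n P F. 1 \<le> n \<and> proper_linear_system G n P \<and> proper_solution G n P F \<and>
        F 1 = Abs_fps (\<lambda>k. if k = 0 then 0 else fps_nth A k))"

end

theory Submission
  imports Defs
begin

text \<open>
  Over the semiring \<open>\<nat>G\<close> nothing cancels, so a proper linear system solved by the complete growth
  series is a finite automaton whose runs have labels \<open>g\<close> in \<open>G\<close> and weights \<open>n \<ge> 1\<close>, and
  \<open>(g, n)\<close> is realised by a run exactly when \<open>g\<close> is a nontrivial element of word length \<open>n\<close>.
  Hence every run from the first state measures the word length of its label exactly, also after a
  cycle has been repeated any number of times.

  Consider the central elements \<open>z^N\<close>. Infinitely many of them have runs that start with one and the
  same prefix \<open>u\<close>, leading to a state that carries a cycle with label \<open>c\<close> and weight \<open>k \<ge> 1\<close>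
  (\<open>pumping\<close>). Inserting \<open>c^T\<close> after the prefix turns \<open>z^N\<close> into \<open>u c^T u^-1 z^N\<close>, whose length is
  therefore that of \<open>z^N\<close> plus \<open>T k\<close>. In the Heisenberg group this is impossible for every \<open>c\<close>.
  If \<open>c\<close> is central, then it is a commutator and its powers are quadratically distorted. If \<open>c\<close> is
  not central, then some \<open>y\<close> satisfies \<open>y^-1 c y = z^d c\<close> with \<open>d > 0\<close>, and conjugating \<open>c^j\<close> by
  \<open>y\<close> produces \<open>z^(d j)\<close> at bounded cost. With \<open>T = j = N div d\<close> the element \<open>u c^T u^-1 z^N\<close> has
  length at most \<open>T k\<close> plus a constant, so infinitely many \<open>z^N\<close> would lie in one finite ball.
  This is \<open>not_gs_rational\<close>, which is proved for any finitely generated group with such elements.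

  It remains to see that the amalgamated product has them. The relators give the normal form
  \<open>x^a y^b z^c\<close> in each factor, from which the two cases for \<open>c\<close> are read off
  (\<open>central_or_twisted\<close>). Integer matrices give an exponent of \<open>z\<close> on the center of each factor; the
  sum of these exponents vanishes on the amalgamated subgroup, so \<open>z\<close> keeps infinite order. A
  cubical-like set generates the group because it contains the generators of every single factor
  (\<open>cubical_generates\<close>).
\<close>

section \<open>Word length\<close>

context monoid
begin

lemma foldr_mult_closed: "set ws \<subseteq> carrier G \<Longrightarrow> foldr (\<otimes>) ws \<one> \<in> carrier G"
  by (induction ws) auto

lemma foldr_mult_append:
  "set us \<subseteq> carrier G \<Longrightarrow> set vs \<subseteq> carrier G \<Longrightarrow>
    foldr (\<otimes>) (us @ vs) \<one> = foldr (\<otimes>) us \<one> \<otimes> foldr (\<otimes>) vs \<one>"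
proof (induction us)
  case Nil
  then show ?case using foldr_mult_closed by simp
next
  case (Cons a us)
  with foldr_mult_closed[of us] foldr_mult_closed[of vs] show ?case
    by (simp add: m_assoc)
qed

end

text \<open>
  Products of generators without inverses must already exhaust the group. Without this the
  minimum that defines the word length would range over an empty set and be arbitrary, and the
  length would not be subadditive.
\<close>

locale monoid_generated = group G for G :: "('a, 'b) monoid_scheme" (structure) +
  fixes S :: "'a set"
  assumes finite_gens: "finite S"
    and gens_closed: "S \<subseteq> carrier G"
    and words_exhaust: "g \<in> carrier G \<Longrightarrow> \<exists>ws. set ws \<subseteq> S \<and> foldr (\<otimes>) ws \<one> = g"
begin

abbreviation len :: "'a \<Rightarrow> nat" where
  "len \<equiv> word_length G S"

lemma len_le: "set ws \<subseteq> S \<Longrightarrow> len (foldr (\<otimes>) ws \<one>) \<le> length ws"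
  unfolding word_length_def by (rule Least_le) blast

lemma len_attained:
  assumes "g \<in> carrier G"
  obtains ws where "length ws = len g" "set ws \<subseteq> S" "foldr (\<otimes>) ws \<one> = g"
proof -
  have "\<exists>n ws. length ws = n \<and> set ws \<subseteq> S \<and> foldr (\<otimes>) ws \<one> = g"
    using words_exhaust[OF assms] by blast
  from LeastI_ex[OF this] show thesis
    using that unfolding word_length_def by blast
qed

lemma len_one: "len \<one> = 0"
  using len_le[of "[]"] by simp

lemma len_mult:
  assumes "g \<in> carrier G" "h \<in> carrier G"
  shows "len (g \<otimes> h) \<le> len g + len h"
proof -
  obtain us where us: "length us = len g" "set us \<subseteq> S" "foldr (\<otimes>) us \<one> = g"
    using len_attained[OF assms(1)] .
  obtain vs where vs: "length vs = len h" "set vs \<subseteq> S" "foldr (\<otimes>) vs \<one> = h"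
    using len_attained[OF assms(2)] .
  show ?thesis
    using len_le[of "us @ vs"] us vs gens_closed
    by (simp add: foldr_mult_append[OF order_trans order_trans] del: foldr_append)
qed

lemma len_pow: "g \<in> carrier G \<Longrightarrow> len (g [^] (n::nat)) \<le> n * len g"
proof (induction n)
  case 0
  then show ?case by (simp add: len_one)
next
  case (Suc n)
  then show ?case using len_mult[of "g [^] n" g] by simp
qed

lemma finite_ball: "finite {g \<in> carrier G. len g \<le> n}"
proof (rule finite_subset)
  show "{g \<in> carrier G. len g \<le> n} \<subseteq>
      (\<lambda>ws. foldr (\<otimes>) ws \<one>) ` {ws. set ws \<subseteq> S \<and> length ws \<le> n}"
  proof
    fix g assume "g \<in> {g \<in> carrier G. len g \<le> n}"
    then show "g \<in> (\<lambda>ws. foldr (\<otimes>) ws \<one>) ` {ws. set ws \<subseteq> S \<and> length ws \<le> n}"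
      by (metis (mono_tags, lifting) image_iff len_attained mem_Collect_eq)
  qed
  show "finite ((\<lambda>ws. foldr (\<otimes>) ws \<one>) ` {ws. set ws \<subseteq> S \<and> length ws \<le> n})"
    by (intro finite_imageI finite_lists_length_le finite_gens)
qed

lemma keys_complete_growth_series:
  "Poly_Mapping.keys (fps_nth (complete_growth_series G S) n) = {g \<in> carrier G. len g = n}"
proof -
  have fin: "finite {g \<in> carrier G. len g = n}"
    by (rule finite_subset[OF _ finite_ball[of n]]) auto
  show ?thesis
    by (simp add: complete_growth_series_def set_eq_iff in_keys_iff lookup_sum lookup_single
        when_def sum.delta[OF fin] del: One_nat_def)
qed

end

lemma monoid_generatedI:
  assumes "group G" and S: "finite_symmetric_generating_set G S"
  shows "monoid_generated G S"
proof -
  interpret group G by (rule assms)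
  have fin: "finite S" and sub: "S \<subseteq> carrier G" and inv_S: "\<And>s. s \<in> S \<Longrightarrow> inv\<^bsub>G\<^esub> s \<in> S"
    and gen: "generate G S = carrier G"
    using S by (auto simp: finite_symmetric_generating_set_def)
  have "\<exists>ws. set ws \<subseteq> S \<and> foldr (\<otimes>\<^bsub>G\<^esub>) ws \<one>\<^bsub>G\<^esub> = g" if "g \<in> generate G S" for g
    using that
  proof (induction rule: generate.induct)
    case one
    show ?case by (rule exI[of _ "[]"]) simp
  next
    case (incl h)
    then show ?case using sub by (intro exI[of _ "[h]"]) auto
  next
    case (inv h)
    then show ?case using sub inv_S
      by (intro exI[of _ "[inv\<^bsub>G\<^esub> h]"]) auto
  next
    case (eng g h)
    then obtain us vs where us: "set us \<subseteq> S" "foldr (\<otimes>\<^bsub>G\<^esub>) us \<one>\<^bsub>G\<^esub> = g"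
      and vs: "set vs \<subseteq> S" "foldr (\<otimes>\<^bsub>G\<^esub>) vs \<one>\<^bsub>G\<^esub> = h" by blast
    then show ?case
      using foldr_mult_append[of us vs] sub
      by (intro exI[of _ "us @ vs"]) (auto simp del: foldr_append)
  qed
  then show ?thesis
    by unfold_locales (use fin sub gen in auto)
qed


section \<open>Supports of rational series\<close>

text \<open>
  Natural coefficients cannot cancel, so supports of sums and products are exactly the unions and
  products of the supports.
\<close>

lemma keys_add_nat:
  fixes p q :: "'a \<Rightarrow>\<^sub>0 nat"
  shows "Poly_Mapping.keys (p + q) = Poly_Mapping.keys p \<union> Poly_Mapping.keys q"
  by (auto simp: in_keys_iff lookup_add)

lemma keys_sum_nat:
  fixes f :: "'i \<Rightarrow> 'a \<Rightarrow>\<^sub>0 nat"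
  shows "finite I \<Longrightarrow> Poly_Mapping.keys (sum f I) = (\<Union>i\<in>I. Poly_Mapping.keys (f i))"
  by (induction I rule: finite_induct) (auto simp: keys_add_nat)

lemma keys_gs_mult:
  "Poly_Mapping.keys (gs_mult G p q) =
     {g \<otimes>\<^bsub>G\<^esub> h | g h. g \<in> Poly_Mapping.keys p \<and> h \<in> Poly_Mapping.keys q}"
  by (fastforce simp: gs_mult_def keys_sum_nat in_keys_iff)

lemma fps_nth_shift_mult:
  "fps_nth (gs_series_mult G (coeff_monom r k) F) n =
     (if k \<le> n then gs_mult G r (fps_nth F (n - k)) else 0)"
proof -
  have *: "gs_mult G (if i = k then r else 0) (fps_nth F (n - i)) =
      (if i = k then gs_mult G r (fps_nth F (n - k)) else 0)" for i
    by (cases "i = k") (simp_all add: gs_mult_def)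
  have "fps_nth (gs_series_mult G (coeff_monom r k) F) n =
      (\<Sum>i=0..n. if i = k then gs_mult G r (fps_nth F (n - k)) else 0)"
    unfolding gs_series_mult_def coeff_monom_def fps_nth_Abs_fps
    by (simp only: *)
  then show ?thesis by (simp add: sum.delta')
qed

lemma fps_nth_sum_list: "fps_nth (sum_list Fs) n = (\<Sum>F\<leftarrow>Fs. fps_nth F n)"
  by (induction Fs) auto

lemma keys_sum_list_nat:
  fixes ps :: "('a \<Rightarrow>\<^sub>0 nat) list"
  shows "Poly_Mapping.keys (sum_list ps) = (\<Union>p\<in>set ps. Poly_Mapping.keys p)"
  by (induction ps) (auto simp: keys_add_nat)

text \<open>
  A linear system is read as a finite automaton: a monomial \<open>r X_j s^k\<close> in the equation for
  \<open>X_i\<close> gives an edge from \<open>i\<close> to \<open>j\<close> for each \<open>h\<close> in the support of \<open>r\<close>, with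
  label \<open>h\<close> and weight \<open>k\<close>; a constant monomial lets a run stop. Multiplicities are
  forgotten, since only supports matter below.
\<close>

definition edge ::
    "(nat \<Rightarrow> ('a \<Rightarrow>\<^sub>0 nat) lin_term list) \<Rightarrow> nat \<Rightarrow> 'a \<Rightarrow> nat \<Rightarrow> nat \<Rightarrow> bool" where
  "edge P i h k j \<longleftrightarrow> (\<exists>r. VarTerm r j k \<in> set (P i) \<and> h \<in> Poly_Mapping.keys r)"

inductive walk ::
    "('a, 'b) monoid_scheme \<Rightarrow> (nat \<Rightarrow> ('a \<Rightarrow>\<^sub>0 nat) lin_term list) \<Rightarrow>
      nat \<Rightarrow> 'a \<Rightarrow> nat \<Rightarrow> nat \<Rightarrow> bool" for G P where
  stay: "walk G P i \<one>\<^bsub>G\<^esub> 0 i"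
| extend: "walk G P i g n j \<Longrightarrow> edge P j h k l \<Longrightarrow> walk G P i (g \<otimes>\<^bsub>G\<^esub> h) (n + k) l"

definition stop :: "(nat \<Rightarrow> ('a \<Rightarrow>\<^sub>0 nat) lin_term list) \<Rightarrow> nat \<Rightarrow> ('a \<times> nat) set" where
  "stop P i = {(g, k). \<exists>r. ConstTerm r k \<in> set (P i) \<and> g \<in> Poly_Mapping.keys r}"

lemma finite_stop: "finite (stop P i)"
proof -
  have "stop P i \<subseteq> (\<Union>t\<in>set (P i). case t of ConstTerm r k \<Rightarrow> Poly_Mapping.keys r \<times> {k} | _ \<Rightarrow> {})"
    by (force simp: stop_def split: lin_term.splits)
  then show ?thesis by (rule finite_subset) (auto split: lin_term.splits)
qed

lemma finite_edges: "finite {(h, k, j). edge P i h k j}"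
proof -
  have "{(h, k, j). edge P i h k j} \<subseteq>
      (\<Union>t\<in>set (P i). case t of VarTerm r j k \<Rightarrow> Poly_Mapping.keys r \<times> {k} \<times> {j} | _ \<Rightarrow> {})"
    by (force simp: edge_def split: lin_term.splits)
  then show ?thesis by (rule finite_subset) (auto split: lin_term.splits)
qed

locale solved_system = group G for G :: "('a, 'b) monoid_scheme" (structure) +
  fixes n :: nat and P F
  assumes system: "proper_linear_system G n P"
    and solution: "proper_solution G n P F"
begin

abbreviation supp :: "nat \<Rightarrow> nat \<Rightarrow> 'a set" where
  "supp i k \<equiv> Poly_Mapping.keys (fps_nth (F i) k)"

lemma supp_closed: "i \<in> {1..n} \<Longrightarrow> supp i k \<subseteq> carrier G"
  using solution unfolding proper_solution_def gs_series_def group_semiring_def by blast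

lemma edgeD:
  assumes "edge P i h k j" "i \<in> {1..n}"
  shows "h \<in> carrier G" "1 \<le> k" "j \<in> {1..n}"
proof -
  obtain r where r: "VarTerm r j k \<in> set (P i)" "h \<in> Poly_Mapping.keys r"
    using assms(1) by (auto simp: edge_def)
  then have "proper_term G n (VarTerm r j k)"
    using system assms(2) unfolding proper_linear_system_def by blast
  then show "h \<in> carrier G" "1 \<le> k" "j \<in> {1..n}"
    using r(2) unfolding proper_term.simps group_semiring_def by blast+
qed

lemma walkD:
  "walk G P i g k j \<Longrightarrow> i \<in> {1..n} \<Longrightarrow> g \<in> carrier G \<and> j \<in> {1..n}"
  by (induction rule: walk.induct) (auto dest: edgeD)

lemma supp_iff:
  assumes "i \<in> {1..n}"
  shows "g \<in> supp i N \<longleftrightarrow> (g, N) \<in> stop P i \<or>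
    (\<exists>h k j w N'. edge P i h k j \<and> w \<in> supp j N' \<and> g = h \<otimes> w \<and> N = k + N')"
    (is "?L \<longleftrightarrow> ?R")
proof -
  have eq: "F i = sum_list (map (eval_term G F) (P i))"
    using solution assms by (auto simp: proper_solution_def)
  have "?L \<longleftrightarrow> (\<exists>t\<in>set (P i). g \<in> Poly_Mapping.keys (fps_nth (eval_term G F t) N))"
    by (subst eq) (simp add: fps_nth_sum_list keys_sum_list_nat)
  also have "\<dots> \<longleftrightarrow> ?R"
  proof
    assume "\<exists>t\<in>set (P i). g \<in> Poly_Mapping.keys (fps_nth (eval_term G F t) N)"
    then obtain t where t: "t \<in> set (P i)" "g \<in> Poly_Mapping.keys (fps_nth (eval_term G F t) N)"
      by blast
    show ?R
    proof (cases t)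
      case (ConstTerm r k)
      then show ?thesis using t by (auto simp: coeff_monom_def stop_def split: if_splits)
    next
      case (VarTerm r j k)
      with t have k: "k \<le> N" and "g \<in> Poly_Mapping.keys (gs_mult G r (fps_nth (F j) (N - k)))"
        by (auto simp: fps_nth_shift_mult split: if_splits)
      then obtain h w where "h \<in> Poly_Mapping.keys r" "w \<in> supp j (N - k)" "g = h \<otimes> w"
        by (auto simp: keys_gs_mult)
      moreover from this(1) have "edge P i h k j"
        using t(1) VarTerm by (auto simp: edge_def)
      moreover have "N = k + (N - k)" using k by simp
      ultimately show ?thesis by blast
    qed
  next
    assume ?R
    then show "\<exists>t\<in>set (P i). g \<in> Poly_Mapping.keys (fps_nth (eval_term G F t) N)"
    proof (elim disjE exE conjE)
      assume "(g, N) \<in> stop P i"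
      then obtain r where "ConstTerm r N \<in> set (P i)" "g \<in> Poly_Mapping.keys r"
        by (auto simp: stop_def)
      then show ?thesis by (intro bexI[of _ "ConstTerm r N"]) (auto simp: coeff_monom_def)
    next
      fix h k j w N'
      assume "edge P i h k j" and w: "w \<in> supp j N'" "g = h \<otimes> w" "N = k + N'"
      then obtain r where "VarTerm r j k \<in> set (P i)" "h \<in> Poly_Mapping.keys r"
        by (auto simp: edge_def)
      with w show ?thesis
        by (intro bexI[of _ "VarTerm r j k"]) (auto simp: fps_nth_shift_mult keys_gs_mult)
    qed
  qed
  finally show ?thesis .
qed

lemma walk_supp:
  "walk G P i g k j \<Longrightarrow> i \<in> {1..n} \<Longrightarrow> w \<in> supp j N \<Longrightarrow> g \<otimes> w \<in> supp i (k + N)"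
proof (induction arbitrary: w N rule: walk.induct)
  case (stay i)
  then show ?case using supp_closed[of i N] by auto
next
  case (extend i g k j h k' l)
  have ij: "g \<in> carrier G" "j \<in> {1..n}" using walkD extend by blast+
  then have l: "h \<in> carrier G" "l \<in> {1..n}" using edgeD extend by blast+
  then have w: "w \<in> carrier G" using supp_closed extend by blast
  have "h \<otimes> w \<in> supp j (k' + N)"
    using extend supp_iff[OF ij(2)] by blast
  then have "g \<otimes> (h \<otimes> w) \<in> supp i (k + (k' + N))" using extend by blast
  then show ?case using ij l w by (simp add: m_assoc add.assoc)
qed

lemma walk_cycle_pow:
  assumes "walk G P s c k s" "s \<in> {1..n}" "w \<in> supp s N"
  shows "c [^] (T::nat) \<otimes> w \<in> supp s (T * k + N)"
proof (induction T)
  case 0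
  have "w \<in> carrier G" using supp_closed assms by blast
  then show ?case using assms by simp
next
  case (Suc T)
  have c: "c \<in> carrier G" using walkD assms by blast
  have w: "w \<in> carrier G" using supp_closed assms by blast
  have "c \<otimes> (c [^] T \<otimes> w) \<in> supp s (k + (T * k + N))"
    using walk_supp[OF assms(1,2) Suc] .
  moreover have "c \<otimes> (c [^] T \<otimes> w) = c [^] Suc T \<otimes> w"
    using c w nat_pow_Suc2[OF c, of T] by (simp add: m_assoc)
  ultimately show ?case by (simp add: add.assoc)
qed

text \<open>
  Infinitely many runs of a finite automaton share a prefix that runs through a cycle. By
  Koenig's argument, if infinitely many members of \<open>E\<close> have runs that start with a given walk,
  then for some edge extending that walk this is still true, because only finitely many edges are
  available and only finitely many runs stop at once. Iterating this gives an infinite walk, which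
  revisits a state. With \<open>u\<close> the label of the walk up to that state and \<open>c\<close> the label of the
  cycle, a member \<open>g = u w\<close> of \<open>E\<close> yields \<open>u c^T w = u c^T u^-1 g\<close>. Each edge has positive
  weight, hence so has the cycle. The point is that \<open>u\<close> and \<open>c\<close> do not depend on \<open>g\<close>.
\<close>

lemma pumping:
  assumes E: "infinite E" "\<And>g N. (g, N) \<in> E \<Longrightarrow> g \<in> supp 1 N" and n: "1 \<le> n"
  obtains u c k where "u \<in> carrier G" "c \<in> carrier G" "1 \<le> k"
    "infinite {(g, N) \<in> E. \<forall>T::nat. u \<otimes> c [^] T \<otimes> inv u \<otimes> g \<in> supp 1 (N + T * k)}"
proof -
  \<comment> \<open>The members of \<open>E\<close> with a run that starts with label \<open>u\<close>, weight \<open>l\<close>, and then is in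
    state \<open>s\<close>.\<close>
  define D where "D = (\<lambda>(u, l, s). {(g, N) \<in> E. \<exists>w N'. w \<in> supp s N' \<and> g = u \<otimes> w \<and> N = l + N'})"
  define good where "good = (\<lambda>(u, l, s). walk G P 1 u l s \<and> infinite (D (u, l, s)))"
  define next_to where "next_to = (\<lambda>(u, l, s) (u', l', s').
      \<exists>h k. edge P s h k s' \<and> u' = u \<otimes> h \<and> l' = l + k)"
  have start: "good (\<one>, 0, 1)"
  proof -
    have "E \<subseteq> D (\<one>, 0, 1)"
      using E(2) supp_closed[of 1] n by (fastforce simp: D_def)
    then show ?thesis using E(1) infinite_super by (auto simp: good_def walk.stay)
  qed
  have continue: "\<exists>y. good y \<and> next_to x y" if "good x" for x
  proof -
    obtain u l s where x: "x = (u, l, s)" by (cases x)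
    have walk: "walk G P 1 u l s" and inf: "infinite (D (u, l, s))"
      using that by (auto simp: good_def x)
    have s: "s \<in> {1..n}" and u: "u \<in> carrier G" using walkD[OF walk] n by auto
    have "D (u, l, s) \<subseteq> (\<lambda>(w, k). (u \<otimes> w, l + k)) ` stop P s \<union>
        (\<Union>(h, k, j)\<in>{(h, k, j). edge P s h k j}. D (u \<otimes> h, l + k, j))"
    proof
      fix e assume "e \<in> D (u, l, s)"
      then obtain g N w N' where e: "e = (g, N)" "e \<in> E"
        and w: "w \<in> supp s N'" "g = u \<otimes> w" "N = l + N'" by (auto simp: D_def)
      from w(1) s consider "(w, N') \<in> stop P s"
        | h k j w' N'' where "edge P s h k j" "w' \<in> supp j N''" "w = h \<otimes> w'" "N' = k + N''"
        by (auto simp: supp_iff)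
      then show "e \<in> (\<lambda>(w, k). (u \<otimes> w, l + k)) ` stop P s \<union>
        (\<Union>(h, k, j)\<in>{(h, k, j). edge P s h k j}. D (u \<otimes> h, l + k, j))"
      proof cases
        case 1
        then show ?thesis using e w by force
      next
        case (2 h k j w' N'')
        have "h \<in> carrier G" "w' \<in> carrier G"
          using edgeD[OF 2(1) s] supp_closed[of j] 2 by auto
        then have "g = u \<otimes> h \<otimes> w'" using w 2 u by (simp add: m_assoc)
        then have "e \<in> D (u \<otimes> h, l + k, j)"
          using e w 2 by (auto simp: D_def)
        then show ?thesis using 2(1) by blast
      qed
    qed
    then have "infinite (\<Union>(h, k, j)\<in>{(h, k, j). edge P s h k j}. D (u \<otimes> h, l + k, j))"
      using inf finite_stop by (meson finite_UnI finite_imageI finite_subset)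
    then obtain h k j where "edge P s h k j" "infinite (D (u \<otimes> h, l + k, j))"
      using finite_edges[of P s] by fastforce
    then show ?thesis
      using walk walk.extend by (fastforce simp: good_def next_to_def x)
  qed
  obtain f where f: "\<And>p. good (f p)" "\<And>p. next_to (f p) (f (Suc p))"
    using dependent_nat_choice[of "\<lambda>_. good" "\<lambda>_. next_to"] start continue by blast
  define state where "state p = snd (snd (f p))" for p
  have state: "state p \<in> {1..n}" for p
    using f(1)[of p] walkD n by (fastforce simp: good_def state_def split: prod.splits)
  have segment: "\<exists>c k. walk G P (state p) c k (state (p + q)) \<and> q \<le> k" for p q
  proof (induction q)
    case 0
    then show ?case using walk.stay by fastforce
  next
    case (Suc q)
    then obtain c k where ck: "walk G P (state p) c k (state (p + q))" "q \<le> k" by blast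
    obtain h k' where h: "edge P (state (p + q)) h k' (state (Suc (p + q)))"
      using f(2)[of "p + q"] by (auto simp: next_to_def state_def split: prod.splits)
    then show ?case
      using walk.extend[OF ck(1) h] ck(2) edgeD(2)[OF h state] by fastforce
  qed
  have "\<not> inj_on state UNIV"
  proof
    assume "inj state"
    moreover have "finite (range state)"
      by (rule finite_subset[of _ "{1..n}"]) (use state in auto)
    ultimately show False using finite_imageD infinite_UNIV_nat by blast
  qed
  then obtain p q where "p < q" "state p = state q"
    by (metis inj_on_def linorder_neqE_nat)
  then obtain c k where c: "walk G P (state p) c k (state p)" "1 \<le> k"
    using segment[of p "q - p"] by fastforce
  obtain u l s where fp: "f p = (u, l, s)" by (cases "f p")
  then have s: "s = state p" by (simp add: state_def)
  have walk: "walk G P 1 u l s" and inf: "infinite (D (u, l, s))"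
    using f(1)[of p] by (auto simp: good_def fp)
  have u: "u \<in> carrier G" and cc: "c \<in> carrier G"
    using walkD[OF walk] walkD[OF c(1) state] n by auto
  have "D (u, l, s) \<subseteq>
      {(g, N) \<in> E. \<forall>T::nat. u \<otimes> c [^] T \<otimes> inv u \<otimes> g \<in> supp 1 (N + T * k)}"
  proof
    fix e assume "e \<in> D (u, l, s)"
    then obtain g N w N' where e: "e = (g, N)" "e \<in> E"
      and w: "w \<in> supp s N'" "g = u \<otimes> w" "N = l + N'" by (auto simp: D_def)
    have wc: "w \<in> carrier G" using supp_closed w state s by blast
    have "u \<otimes> c [^] T \<otimes> inv u \<otimes> g \<in> supp 1 (N + T * k)" for T :: nat
    proof -
      have "u \<otimes> (c [^] T \<otimes> w) \<in> supp 1 (l + (T * k + N'))"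
        using walk_supp[OF walk] walk_cycle_pow[OF c(1) state] w s n by auto
      moreover have "u \<otimes> c [^] T \<otimes> inv u \<otimes> g = u \<otimes> (c [^] T \<otimes> w)"
        using u cc wc w by (simp add: m_assoc) (simp add: m_assoc[symmetric])
      ultimately show ?thesis using w by (simp add: ac_simps)
    qed
    then show "e \<in> {(g, N) \<in> E. \<forall>T::nat. u \<otimes> c [^] T \<otimes> inv u \<otimes> g \<in> supp 1 (N + T * k)}"
      using e by auto
  qed
  then have "infinite {(g, N) \<in> E. \<forall>T::nat. u \<otimes> c [^] T \<otimes> inv u \<otimes> g \<in> supp 1 (N + T * k)}"
    using inf infinite_super by blast
  then show thesis using that u cc c(2) by blast
qed

end


section \<open>Obstruction to rationality\<close>

context group
begin

lemma int_pow_conj: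
  assumes "a \<in> carrier G" "b \<in> carrier G"
  shows "(b \<otimes> a \<otimes> inv b) [^] (n::int) = b \<otimes> a [^] n \<otimes> inv b"
proof -
  have "(\<lambda>x. b \<otimes> x \<otimes> inv b) \<in> hom G G"
  proof (rule homI)
    fix x y assume "x \<in> carrier G" "y \<in> carrier G"
    then show "b \<otimes> (x \<otimes> y) \<otimes> inv b = b \<otimes> x \<otimes> inv b \<otimes> (b \<otimes> y \<otimes> inv b)"
      using assms(2) by (simp add: m_assoc) (simp add: m_assoc[symmetric])
  qed (use assms(2) in simp)
  from hom_int_pow[OF this assms(1) is_group is_group] show ?thesis by simp
qed

text \<open>
  If \<open>a b = t b a\<close> with \<open>t\<close> commuting with \<open>b\<close>, then conjugation by \<open>a\<close> sends \<open>b\<close> to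
  \<open>t b\<close>, hence \<open>b^n\<close> to \<open>t^n b^n\<close>.
\<close>

lemma twisted_pow_right:
  assumes "a \<in> carrier G" "b \<in> carrier G" "t \<in> carrier G"
    and "a \<otimes> b = t \<otimes> (b \<otimes> a)" "t \<otimes> b = b \<otimes> t"
  shows "a \<otimes> b [^] (n::int) = t [^] n \<otimes> (b [^] n \<otimes> a)"
proof -
  have "a \<otimes> b \<otimes> inv a = t \<otimes> b"
    using assms(1-3) by (simp add: assms(4) m_assoc)
  then have "a \<otimes> b [^] n \<otimes> inv a = (t \<otimes> b) [^] n"
    using int_pow_conj[OF assms(2,1), of n] by simp
  also have "\<dots> = t [^] n \<otimes> b [^] n"
    using int_pow_mult_distrib[OF assms(5,3,2)] .
  finally have "a \<otimes> b [^] n \<otimes> inv a \<otimes> a = t [^] n \<otimes> b [^] n \<otimes> a" by simp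
  then show ?thesis using assms(1-3) by (simp add: m_assoc)
qed

lemma twisted_pow_left:
  assumes "a \<in> carrier G" "b \<in> carrier G" "t \<in> carrier G"
    and "a \<otimes> b = t \<otimes> (b \<otimes> a)" "t \<otimes> a = a \<otimes> t"
  shows "a [^] (n::int) \<otimes> b = t [^] n \<otimes> (b \<otimes> a [^] n)"
proof -
  have "inv t \<otimes> a = a \<otimes> inv t"
    using assms(1,3,5) by (metis inv_closed inv_solve_left inv_solve_right m_assoc m_closed)
  moreover have "b \<otimes> a = inv t \<otimes> (a \<otimes> b)"
    using assms(1-4) by (simp add: m_assoc[symmetric])
  ultimately have "b \<otimes> a [^] n = inv t [^] n \<otimes> (a [^] n \<otimes> b)"
    using twisted_pow_right[of b a "inv t" n] assms(1-3) by simp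
  then show ?thesis
    using assms(1-3) by (simp add: int_pow_inv m_assoc[symmetric])
qed

end

text \<open>
  Replacing \<open>y\<close> by its inverse changes the sign of the exponent.
\<close>

lemma (in group) twisted_nat_exponent:
  assumes "c \<in> carrier G" "y \<in> carrier G" "z \<in> carrier G"
    and "c \<otimes> y = z [^] (d::int) \<otimes> (y \<otimes> c)" "z \<otimes> y = y \<otimes> z" "d \<noteq> 0"
  shows "\<exists>y\<in>carrier G. \<exists>n::nat. 0 < n \<and> c \<otimes> y = z [^] n \<otimes> (y \<otimes> c)"
proof (cases "0 < d")
  case True
  then show ?thesis
    using assms by (intro bexI[of _ y] exI[of _ "nat d"]) (auto simp: pow_nat)
next
  case False
  have zy: "z [^] d \<otimes> y = y \<otimes> z [^] d"
    using twisted_pow_left[of z y \<one> d] assms by simp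
  have "c \<otimes> y [^] (-1::int) = (z [^] d) [^] (-1::int) \<otimes> (y [^] (-1::int) \<otimes> c)"
    by (rule twisted_pow_right) (use assms zy in auto)
  moreover have "(z [^] d) [^] (-1::int) = z [^] nat (- d)"
    using False assms by (simp add: int_pow_pow pow_nat)
  ultimately show ?thesis
    using False assms by (intro bexI[of _ "y [^] (-1::int)"] exI[of _ "nat (- d)"]) auto
qed

context monoid_generated
begin

lemma len_eq_0:
  assumes "g \<in> carrier G" "len g = 0"
  shows "g = \<one>"
  using len_attained[OF assms(1)] assms(2) by (metis foldr.simps(1) id_apply length_0_conv)

lemma len_conj:
  assumes "u \<in> carrier G" "g \<in> carrier G" "h \<in> carrier G"
  shows "len (u \<otimes> g \<otimes> inv u \<otimes> h) \<le> len u + len g + len (inv u \<otimes> h)"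
  using len_mult[of u g] len_mult[of "u \<otimes> g" "inv u \<otimes> h"] assms by (simp add: m_assoc)

text \<open>
  A commutator \<open>c = [x, y]\<close> that commutes with \<open>x\<close> and \<open>y\<close> satisfies \<open>c^(n^2) = [x^n, y^n]\<close>,
  so its powers are much shorter than their exponents suggest.
\<close>

lemma central_commutator_distorted:
  assumes "x \<in> carrier G" "y \<in> carrier G" "c \<in> carrier G"
    and "x \<otimes> y = c \<otimes> (y \<otimes> x)" "c \<otimes> x = x \<otimes> c" "c \<otimes> y = y \<otimes> c"
  shows "len (c [^] (n * n)) \<le> n * (len x + len y + len (inv x) + len (inv y))"
proof -
  have 1: "x [^] n \<otimes> y = c [^] n \<otimes> (y \<otimes> x [^] n)"
    using twisted_pow_left[OF assms(1-5), of "int n"] by (simp add: int_pow_int)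
  have "c [^] n \<otimes> y = y \<otimes> c [^] n"
    using group_commutes_pow assms by blast
  then have "x [^] n \<otimes> y [^] n = (c [^] n) [^] n \<otimes> (y [^] n \<otimes> x [^] n)"
    using twisted_pow_right[of "x [^] n" y "c [^] n" "int n"] 1 assms(1-3)
    by (simp add: int_pow_int)
  then have "c [^] (n * n) = x [^] n \<otimes> y [^] n \<otimes> inv (y [^] n \<otimes> x [^] n)"
    using assms(1-3) by (simp add: inv_solve_right nat_pow_pow)
  then have "c [^] (n * n) = x [^] n \<otimes> (y [^] n \<otimes> (inv x [^] n \<otimes> inv y [^] n))"
    using assms(1-3) by (simp add: inv_mult_group nat_pow_inv m_assoc)
  then have "len (c [^] (n * n)) \<le> len (x [^] n) + (len (y [^] n) + (len (inv x [^] n) + len (inv y [^] n)))"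
    using assms(1,2) by (auto intro!: len_mult[THEN order_trans] add_left_mono)
  also have "\<dots> \<le> n * len x + (n * len y + (n * len (inv x) + n * len (inv y)))"
    using assms(1-3) by (intro add_mono len_pow) auto
  finally show ?thesis by (simp add: algebra_simps)
qed

text \<open>
  Rationality would give, by pumping the elements \<open>z^N\<close>, fixed \<open>u\<close>, \<open>c\<close> and \<open>k \<ge> 1\<close> such
  that \<open>u c^T u^-1 z^N\<close> has length exactly \<open>T k\<close> more than \<open>z^N\<close>, for all \<open>T\<close> and infinitely
  many \<open>N\<close>. If \<open>c = [x, y]\<close> commutes with \<open>x\<close> and \<open>y\<close>, this linear growth in \<open>T\<close> contradicts
  distortion. Otherwise \<open>y^-1 c^j y = z^(d j) c^j\<close> for some \<open>y\<close> and \<open>d > 0\<close>, so the factor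
  \<open>z^N\<close>, up to a remainder \<open>z^r\<close> with \<open>r < d\<close>, is produced from \<open>c^j\<close> by a conjugation
  whose cost does not depend on \<open>j = N div d\<close>. Taking \<open>T = j\<close> bounds the length of \<open>z^N\<close> by a
  constant, whereas balls are finite.
\<close>

theorem not_gs_rational:
  assumes z: "z \<in> carrier G" and central: "\<And>g. g \<in> carrier G \<Longrightarrow> z \<otimes> g = g \<otimes> z"
    and inj: "inj (\<lambda>n::nat. z [^] n)"
    and central_or_twisted: "\<And>c. c \<in> carrier G \<Longrightarrow>
      (\<exists>x\<in>carrier G. \<exists>y\<in>carrier G. x \<otimes> y = c \<otimes> (y \<otimes> x) \<and> c \<otimes> x = x \<otimes> c \<and> c \<otimes> y = y \<otimes> c) \<or>
      (\<exists>y\<in>carrier G. \<exists>d::nat. 0 < d \<and> c \<otimes> y = z [^] d \<otimes> (y \<otimes> c))"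
  shows "\<not> gs_rational G (complete_growth_series G S)"
proof
  assume "gs_rational G (complete_growth_series G S)"
  then obtain n P F where n: "1 \<le> n" and sys: "proper_linear_system G n P" "proper_solution G n P F"
    and F1: "F 1 = Abs_fps (\<lambda>k. if k = 0 then 0 else fps_nth (complete_growth_series G S) k)"
    unfolding gs_rational_def by blast
  interpret solved_system G n P F
    by unfold_locales (rule sys)+
  have supp1: "g \<in> supp 1 k \<longleftrightarrow> k \<noteq> 0 \<and> g \<in> carrier G \<and> len g = k" for g k
    unfolding F1 using keys_complete_growth_series[of k] by simp
  define E where "E = (\<lambda>N::nat. (z [^] N, len (z [^] N))) ` {1..}"
  have nontrivial: "len (z [^] N) \<noteq> 0" if "1 \<le> N" for N :: nat
    using len_eq_0[of "z [^] N"] z injD[OF inj, of N 0] that by auto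
  have injE: "inj (\<lambda>N::nat. (z [^] N, len (z [^] N)))"
    using inj by (auto simp: inj_on_def)
  have "infinite E"
    unfolding E_def using finite_imageD[OF _ inj_on_subset[OF injE subset_UNIV]] infinite_Ici by blast
  have E_supp: "g \<in> supp 1 N" if "(g, N) \<in> E" for g N
    using that nontrivial z by (auto simp: E_def supp1 simp del: One_nat_def)
  obtain u c k where u: "u \<in> carrier G" and c: "c \<in> carrier G" and k: "1 \<le> k"
    and inf: "infinite {(g, N) \<in> E. \<forall>T::nat. u \<otimes> c [^] T \<otimes> inv u \<otimes> g \<in> supp 1 (N + T * k)}"
    by (rule pumping[OF \<open>infinite E\<close> E_supp n])
  define M where "M = {N::nat. \<forall>T::nat. len (u \<otimes> c [^] T \<otimes> inv u \<otimes> z [^] N) = len (z [^] N) + T * k}"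
  have "{(g, N) \<in> E. \<forall>T::nat. u \<otimes> c [^] T \<otimes> inv u \<otimes> g \<in> supp 1 (N + T * k)} \<subseteq>
      (\<lambda>N::nat. (z [^] N, len (z [^] N))) ` M"
    by (auto simp: E_def M_def supp1 simp del: One_nat_def)
  then have infM: "infinite M"
    using inf finite_imageI finite_subset by blast
  then obtain N\<^sub>0 where N\<^sub>0: "N\<^sub>0 \<in> M" using infinite_imp_nonempty by blast
  have pumped: "len (u \<otimes> c [^] T \<otimes> inv u \<otimes> z [^] N) = len (z [^] N) + T * k"
    if "N \<in> M" for N T :: nat
    using that by (simp add: M_def)
  from central_or_twisted[OF c] show False
  proof (elim disjE bexE exE conjE)
    fix x y
    assume x: "x \<in> carrier G" and y: "y \<in> carrier G"
      and xy: "x \<otimes> y = c \<otimes> (y \<otimes> x)" "c \<otimes> x = x \<otimes> c" "c \<otimes> y = y \<otimes> c"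
    define B where "B = len x + len y + len (inv x) + len (inv y)"
    define C where "C = len u + len (inv u \<otimes> z [^] N\<^sub>0)"
    \<comment> \<open>Chosen so that \<open>p * p\<close> exceeds the bound \<open>p * B + C\<close> that distortion gives.\<close>
    define p where "p = B + C + 1"
    have "p * p \<le> p * p * k"
      using mult_le_mono2[OF k, of "p * p"] by (simp only: mult_1_right)
    also have "\<dots> \<le> len (u \<otimes> c [^] (p * p) \<otimes> inv u \<otimes> z [^] N\<^sub>0)"
      using pumped[OF N\<^sub>0] by simp
    also have "\<dots> \<le> len u + len (c [^] (p * p)) + len (inv u \<otimes> z [^] N\<^sub>0)"
      using len_conj u c z by blast
    also have "\<dots> \<le> p * B + C"
      using central_commutator_distorted[OF x y c xy, of p] by (simp add: B_def C_def)
    also have "\<dots> < p * p" by (simp add: p_def algebra_simps)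
    finally show False by simp
  next
    fix y and d :: nat
    assume y: "y \<in> carrier G" and d: "0 < d" and cy: "c \<otimes> y = z [^] d \<otimes> (y \<otimes> c)"
    define C where "C = len (inv u) + len (z [^] N\<^sub>0) + len (inv (z [^] N\<^sub>0) \<otimes> u)"
    \<comment> \<open>Pumping the single element with exponent \<open>N\<^sub>0\<close> shows that \<open>c^j\<close> costs at most \<open>k\<close> per
      factor, up to a constant.\<close>
    have len_c: "len (c [^] j) \<le> j * k + C" for j :: nat
    proof -
      let ?g = "u \<otimes> c [^] j \<otimes> inv u \<otimes> z [^] N\<^sub>0"
      have "c [^] j = inv u \<otimes> ?g \<otimes> (inv (z [^] N\<^sub>0) \<otimes> u)"
        using u c z by (simp add: m_assoc inv_solve_left') (simp add: m_assoc[symmetric])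
      then show ?thesis
        using len_mult[of "inv u \<otimes> ?g" "inv (z [^] N\<^sub>0) \<otimes> u"] len_mult[of "inv u" ?g]
          pumped[OF N\<^sub>0, of j] u c z by (simp add: C_def)
    qed
    define K where "K = C + len (u \<otimes> inv y) + len (y \<otimes> inv u) + d * len z"
    have "len (z [^] N) \<le> K" if N: "N \<in> M" for N
    proof -
      let ?j = "N div d" and ?r = "N mod d"
      have zc: "z [^] i \<otimes> g = g \<otimes> z [^] i" if "g \<in> carrier G" for g and i :: nat
        using group_commutes_pow central that z by blast
      have "c [^] ?j \<otimes> y = (z [^] d) [^] ?j \<otimes> (y \<otimes> c [^] ?j)"
        using twisted_pow_left[of c y "z [^] d" "int ?j"] c y z cy zc by (simp add: int_pow_int)
      then have "inv y \<otimes> (c [^] ?j \<otimes> y) = (inv y \<otimes> z [^] (d * ?j)) \<otimes> (y \<otimes> c [^] ?j)"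
        using y c z by (simp add: nat_pow_pow m_assoc)
      also have "\<dots> = z [^] (d * ?j) \<otimes> (inv y \<otimes> (y \<otimes> c [^] ?j))"
        using y c z by (simp add: zc[symmetric] m_assoc)
      also have "\<dots> = z [^] (d * ?j) \<otimes> c [^] ?j"
        using y c by (simp add: m_assoc[symmetric])
      finally have conj: "inv y \<otimes> (c [^] ?j \<otimes> y) = z [^] (d * ?j) \<otimes> c [^] ?j" .
      have "u \<otimes> c [^] ?j \<otimes> inv u \<otimes> z [^] N = u \<otimes> c [^] ?j \<otimes> (inv u \<otimes> z [^] (d * ?j)) \<otimes> z [^] ?r"
        using u c z by (simp add: m_assoc nat_pow_mult)
      also have "\<dots> = u \<otimes> (c [^] ?j \<otimes> z [^] (d * ?j)) \<otimes> inv u \<otimes> z [^] ?r"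
        using u c z by (simp only: zc[OF inv_closed[OF u], symmetric]) (simp add: m_assoc)
      also have "\<dots> = u \<otimes> (inv y \<otimes> (c [^] ?j \<otimes> y)) \<otimes> inv u \<otimes> z [^] ?r"
        using c by (simp add: conj zc)
      also have "\<dots> = (u \<otimes> inv y) \<otimes> c [^] ?j \<otimes> (y \<otimes> inv u) \<otimes> z [^] ?r"
        using u c y z by (simp add: m_assoc)
      finally have "len (z [^] N) + ?j * k =
          len ((u \<otimes> inv y) \<otimes> c [^] ?j \<otimes> (y \<otimes> inv u) \<otimes> z [^] ?r)"
        using pumped[OF N, of ?j] by simp
      also have "\<dots> \<le> len (u \<otimes> inv y) + len (c [^] ?j) + len (y \<otimes> inv u) + len (z [^] ?r)"
        using len_mult[of "u \<otimes> inv y" "c [^] ?j"]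
          len_mult[of "u \<otimes> inv y \<otimes> c [^] ?j" "y \<otimes> inv u"]
          len_mult[of "u \<otimes> inv y \<otimes> c [^] ?j \<otimes> (y \<otimes> inv u)" "z [^] ?r"] u c y z by simp
      also have "\<dots> \<le> len (u \<otimes> inv y) + (?j * k + C) + len (y \<otimes> inv u) + d * len z"
        using d by (intro add_mono order_refl len_c len_pow[OF z, THEN order_trans] mult_right_mono) auto
      finally show ?thesis by (simp add: K_def)
    qed
    then have "(\<lambda>N. z [^] N) ` M \<subseteq> {g \<in> carrier G. len g \<le> K}" using z by auto
    then have "finite M"
      using finite_ball finite_subset finite_imageD[OF _ inj_on_subset[OF inj subset_UNIV]] by meson
    with infM show False ..
  qed
qed

end


section \<open>The Heisenberg group of rank three\<close>

interpretation H3: group H3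
  by (rule group_H3)

definition heis_x :: "heis_gen word set" where
  "heis_x = word_class heis_relators [(Gen_x, True)]"

definition heis_y :: "heis_gen word set" where
  "heis_y = word_class heis_relators [(Gen_y, True)]"

lemma heis_word_class_closed [simp]: "word_class heis_relators w \<in> carrier H3"
  by (simp add: H3_def carrier_presented_group)

lemma heis_x_closed [simp]: "heis_x \<in> carrier H3"
  and heis_y_closed [simp]: "heis_y \<in> carrier H3"
  by (simp_all add: heis_x_def heis_y_def)

lemmas heis_z_closed [simp] = heis_z_in_carrier

lemma H3_mult_classes:
  "word_class heis_relators u \<otimes>\<^bsub>H3\<^esub> word_class heis_relators v = word_class heis_relators (u @ v)"
  by (simp add: H3_def mult_word_class)

lemma H3_one: "\<one>\<^bsub>H3\<^esub> = word_class heis_relators []"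
  by (simp add: H3_def one_presented_group)

lemma H3_inv_class:
  "inv\<^bsub>H3\<^esub> word_class heis_relators w = word_class heis_relators (inv_word w)"
  by (rule H3.inv_equality) (simp_all add: H3_mult_classes H3_one word_class_eq_iff pres_eq_inv_word)

lemma heis_xy: "heis_x \<otimes>\<^bsub>H3\<^esub> heis_y = heis_z \<otimes>\<^bsub>H3\<^esub> (heis_y \<otimes>\<^bsub>H3\<^esub> heis_x)"
proof -
  have "heis_z = heis_x \<otimes>\<^bsub>H3\<^esub> heis_y \<otimes>\<^bsub>H3\<^esub> inv\<^bsub>H3\<^esub> heis_x \<otimes>\<^bsub>H3\<^esub> inv\<^bsub>H3\<^esub> heis_y"
    by (simp add: heis_z_def heis_x_def heis_y_def H3_inv_class H3_mult_classes heis_z_word_def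
        comm_word_def)
  then have "heis_z \<otimes>\<^bsub>H3\<^esub> heis_y \<otimes>\<^bsub>H3\<^esub> heis_x = heis_x \<otimes>\<^bsub>H3\<^esub> heis_y"
    using heis_x_closed heis_y_closed
    by (metis H3.inv_closed H3.inv_solve_right' H3.m_closed heis_z_closed)
  then show ?thesis by (simp add: H3.m_assoc)
qed

lemma heis_Z_eq: "heis_Z = range (\<lambda>k::int. heis_z [^]\<^bsub>H3\<^esub> k)"
  unfolding heis_Z_def by (auto simp: H3.generate_pow[OF heis_z_closed])

lemma heis_z_pow_commutes:
  "g \<in> carrier H3 \<Longrightarrow> heis_z [^]\<^bsub>H3\<^esub> (k::int) \<otimes>\<^bsub>H3\<^esub> g = g \<otimes>\<^bsub>H3\<^esub> heis_z [^]\<^bsub>H3\<^esub> k"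
  by (rule heis_Z_commutes) (auto simp: heis_Z_eq)

lemma heis_xy_pow:
  "heis_x [^]\<^bsub>H3\<^esub> (a::int) \<otimes>\<^bsub>H3\<^esub> heis_y [^]\<^bsub>H3\<^esub> (b::int) =
    heis_z [^]\<^bsub>H3\<^esub> (a * b) \<otimes>\<^bsub>H3\<^esub> (heis_y [^]\<^bsub>H3\<^esub> b \<otimes>\<^bsub>H3\<^esub> heis_x [^]\<^bsub>H3\<^esub> a)"
proof -
  have "heis_x [^]\<^bsub>H3\<^esub> a \<otimes>\<^bsub>H3\<^esub> heis_y = heis_z [^]\<^bsub>H3\<^esub> a \<otimes>\<^bsub>H3\<^esub> (heis_y \<otimes>\<^bsub>H3\<^esub> heis_x [^]\<^bsub>H3\<^esub> a)"
    by (rule H3.twisted_pow_left) (simp_all add: heis_xy heis_z_commutes)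
  then have "heis_x [^]\<^bsub>H3\<^esub> a \<otimes>\<^bsub>H3\<^esub> heis_y [^]\<^bsub>H3\<^esub> b =
      (heis_z [^]\<^bsub>H3\<^esub> a) [^]\<^bsub>H3\<^esub> b \<otimes>\<^bsub>H3\<^esub> (heis_y [^]\<^bsub>H3\<^esub> b \<otimes>\<^bsub>H3\<^esub> heis_x [^]\<^bsub>H3\<^esub> a)"
    by (intro H3.twisted_pow_right) (simp_all add: heis_z_pow_commutes)
  then show ?thesis by (simp add: H3.int_pow_pow)
qed

lemma heis_normal_form:
  assumes "g \<in> carrier H3"
  shows "\<exists>(a::int) (b::int) (c::int). g = heis_x [^]\<^bsub>H3\<^esub> a \<otimes>\<^bsub>H3\<^esub> (heis_y [^]\<^bsub>H3\<^esub> b \<otimes>\<^bsub>H3\<^esub> heis_z [^]\<^bsub>H3\<^esub> c)"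
proof -
  have "\<exists>(a::int) (b::int) (c::int). word_class heis_relators w =
      heis_x [^]\<^bsub>H3\<^esub> a \<otimes>\<^bsub>H3\<^esub> (heis_y [^]\<^bsub>H3\<^esub> b \<otimes>\<^bsub>H3\<^esub> heis_z [^]\<^bsub>H3\<^esub> c)" for w
  proof (induction w)
    case Nil
    show ?case by (intro exI[of _ "0::int"]) (simp add: H3_one[symmetric])
  next
    case (Cons l w)
    then obtain a b c :: int where w: "word_class heis_relators w =
        heis_x [^]\<^bsub>H3\<^esub> a \<otimes>\<^bsub>H3\<^esub> (heis_y [^]\<^bsub>H3\<^esub> b \<otimes>\<^bsub>H3\<^esub> heis_z [^]\<^bsub>H3\<^esub> c)" by blast
    have lw: "word_class heis_relators (l # w) =
        word_class heis_relators [l] \<otimes>\<^bsub>H3\<^esub> word_class heis_relators w"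
      by (simp add: H3_mult_classes)
    obtain h e where l: "l = (h, e)" by (cases l)
    define i :: int where "i = (if e then 1 else -1)"
    have inverse_letter: "word_class heis_relators [(h, False)] =
        inv\<^bsub>H3\<^esub> word_class heis_relators [(h, True)]" for h
      by (simp add: H3_inv_class inv_word_def)
    have letter: "word_class heis_relators [l] =
        (case h of Gen_x \<Rightarrow> heis_x [^]\<^bsub>H3\<^esub> i | Gen_y \<Rightarrow> heis_y [^]\<^bsub>H3\<^esub> i)"
      by (cases h; cases e)
        (simp_all add: l i_def inverse_letter heis_x_def heis_y_def H3.int_pow_neg)
    show ?case
    proof (cases h)
      case Gen_x
      then have "word_class heis_relators (l # w) =
          heis_x [^]\<^bsub>H3\<^esub> (i + a) \<otimes>\<^bsub>H3\<^esub> (heis_y [^]\<^bsub>H3\<^esub> b \<otimes>\<^bsub>H3\<^esub> heis_z [^]\<^bsub>H3\<^esub> c)"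
        by (simp add: lw letter w H3.int_pow_mult H3.m_assoc)
      then show ?thesis by blast
    next
      case Gen_y
      let ?X = "heis_x [^]\<^bsub>H3\<^esub> a" and ?Y = "heis_y [^]\<^bsub>H3\<^esub> i"
      have "?Y \<otimes>\<^bsub>H3\<^esub> ?X = heis_z [^]\<^bsub>H3\<^esub> (- (a * i)) \<otimes>\<^bsub>H3\<^esub> (?X \<otimes>\<^bsub>H3\<^esub> ?Y)"
        by (simp add: heis_xy_pow H3.int_pow_neg H3.m_assoc[symmetric])
      then have "?Y \<otimes>\<^bsub>H3\<^esub> ?X = ?X \<otimes>\<^bsub>H3\<^esub> ?Y \<otimes>\<^bsub>H3\<^esub> heis_z [^]\<^bsub>H3\<^esub> (- (a * i))"
        by (simp add: heis_z_pow_commutes)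
      then have "?Y \<otimes>\<^bsub>H3\<^esub> ?X \<otimes>\<^bsub>H3\<^esub> (heis_y [^]\<^bsub>H3\<^esub> b \<otimes>\<^bsub>H3\<^esub> heis_z [^]\<^bsub>H3\<^esub> c) =
          ?X \<otimes>\<^bsub>H3\<^esub> (?Y \<otimes>\<^bsub>H3\<^esub> (heis_z [^]\<^bsub>H3\<^esub> (- (a * i)) \<otimes>\<^bsub>H3\<^esub> heis_y [^]\<^bsub>H3\<^esub> b) \<otimes>\<^bsub>H3\<^esub> heis_z [^]\<^bsub>H3\<^esub> c)"
        by (simp add: H3.m_assoc)
      also have "\<dots> = ?X \<otimes>\<^bsub>H3\<^esub> (heis_y [^]\<^bsub>H3\<^esub> (i + b) \<otimes>\<^bsub>H3\<^esub> heis_z [^]\<^bsub>H3\<^esub> (- (a * i) + c))"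
        by (simp only: heis_z_pow_commutes[OF H3.int_pow_closed[OF heis_y_closed]])
          (simp add: H3.int_pow_mult H3.m_assoc del: uminus_add_conv_diff)
      finally have "word_class heis_relators (l # w) =
          ?X \<otimes>\<^bsub>H3\<^esub> (heis_y [^]\<^bsub>H3\<^esub> (i + b) \<otimes>\<^bsub>H3\<^esub> heis_z [^]\<^bsub>H3\<^esub> (- (a * i) + c))"
        by (simp add: lw letter w Gen_y H3.m_assoc)
      then show ?thesis by blast
    qed
  qed
  moreover obtain w where "g = word_class heis_relators w"
    using assms by (auto simp: H3_def carrier_presented_group)
  ultimately show ?thesis by blast
qed

text \<open>
  In normal form, \<open>x^a y^b z^c\<close> has commutator \<open>z^a\<close> with \<open>y\<close> and
  \<open>z^(-b)\<close> with \<open>x\<close>; outside the center one of \<open>a\<close>, \<open>b\<close> is nonzero.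
\<close>

lemma heis_noncentral:
  assumes g: "g \<in> carrier H3" "g \<notin> heis_Z"
  obtains y d where "y \<in> carrier H3" "d \<noteq> (0::int)"
    "g \<otimes>\<^bsub>H3\<^esub> y = heis_z [^]\<^bsub>H3\<^esub> d \<otimes>\<^bsub>H3\<^esub> (y \<otimes>\<^bsub>H3\<^esub> g)"
proof -
  obtain a b c :: int where abc: "g = heis_x [^]\<^bsub>H3\<^esub> a \<otimes>\<^bsub>H3\<^esub> (heis_y [^]\<^bsub>H3\<^esub> b \<otimes>\<^bsub>H3\<^esub> heis_z [^]\<^bsub>H3\<^esub> c)"
    using heis_normal_form[OF g(1)] by blast
  let ?X = "heis_x [^]\<^bsub>H3\<^esub> a" and ?Y = "heis_y [^]\<^bsub>H3\<^esub> b" and ?Z = "heis_z [^]\<^bsub>H3\<^esub> c"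
  have "a \<noteq> 0 \<or> b \<noteq> 0" using g(2) by (auto simp: abc heis_Z_eq)
  then show thesis
  proof
    assume a: "a \<noteq> 0"
    have "?Y \<otimes>\<^bsub>H3\<^esub> heis_y = heis_y \<otimes>\<^bsub>H3\<^esub> ?Y"
      using H3.int_pow_mult[of heis_y b 1] H3.int_pow_mult[of heis_y 1 b] by (simp add: add.commute)
    then have "g \<otimes>\<^bsub>H3\<^esub> heis_y = ?X \<otimes>\<^bsub>H3\<^esub> heis_y \<otimes>\<^bsub>H3\<^esub> (?Y \<otimes>\<^bsub>H3\<^esub> ?Z)"
      by (simp add: abc H3.m_assoc heis_z_pow_commutes) (simp add: H3.m_assoc[symmetric])
    also have "\<dots> = heis_z [^]\<^bsub>H3\<^esub> a \<otimes>\<^bsub>H3\<^esub> (heis_y \<otimes>\<^bsub>H3\<^esub> g)"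
      using heis_xy_pow[of a 1] by (simp add: abc H3.m_assoc)
    finally show thesis using that[OF heis_y_closed a] by blast
  next
    assume b: "b \<noteq> 0"
    have xX: "?X \<otimes>\<^bsub>H3\<^esub> heis_x = heis_x \<otimes>\<^bsub>H3\<^esub> ?X"
      using H3.int_pow_mult[of heis_x a 1] H3.int_pow_mult[of heis_x 1 a] by (simp add: add.commute)
    have "heis_z [^]\<^bsub>H3\<^esub> (- b) \<otimes>\<^bsub>H3\<^esub> (heis_x \<otimes>\<^bsub>H3\<^esub> ?Y) = ?Y \<otimes>\<^bsub>H3\<^esub> heis_x"
      using heis_xy_pow[of 1 b] by (simp add: H3.int_pow_neg H3.m_assoc[symmetric])
    then have "g \<otimes>\<^bsub>H3\<^esub> heis_x = ?X \<otimes>\<^bsub>H3\<^esub> (heis_z [^]\<^bsub>H3\<^esub> (- b) \<otimes>\<^bsub>H3\<^esub> (heis_x \<otimes>\<^bsub>H3\<^esub> ?Y)) \<otimes>\<^bsub>H3\<^esub> ?Z"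
      by (simp add: abc H3.m_assoc heis_z_pow_commutes)
    also have "\<dots> = heis_z [^]\<^bsub>H3\<^esub> (- b) \<otimes>\<^bsub>H3\<^esub> (?X \<otimes>\<^bsub>H3\<^esub> heis_x \<otimes>\<^bsub>H3\<^esub> ?Y \<otimes>\<^bsub>H3\<^esub> ?Z)"
      using heis_z_pow_commutes[of ?X "- b"] by (simp add: H3.m_assoc[symmetric])
    also have "\<dots> = heis_z [^]\<^bsub>H3\<^esub> (- b) \<otimes>\<^bsub>H3\<^esub> (heis_x \<otimes>\<^bsub>H3\<^esub> g)"
      by (simp add: xX abc H3.m_assoc)
    finally show thesis using that[of heis_x "- b"] b by simp
  qed
qed

section \<open>Integer matrices and the order of the center\<close>

text \<open>
  The triple \<open>(a, b, c)\<close> stands for the unitriangular integer matrix with entries \<open>a\<close>, \<open>b\<close>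
  next to the diagonal and \<open>c\<close> in the corner. This model shows that the central generator has
  infinite order.
\<close>

fun heis_mul :: "int \<times> int \<times> int \<Rightarrow> int \<times> int \<times> int \<Rightarrow> int \<times> int \<times> int" where
  "heis_mul (a, b, c) (a', b', c') = (a + a', b + b', c + c' + a * b')"

fun letter_matrix :: "heis_gen \<times> bool \<Rightarrow> int \<times> int \<times> int" where
  "letter_matrix (Gen_x, e) = ((if e then 1 else -1), 0, 0)"
| "letter_matrix (Gen_y, e) = (0, (if e then 1 else -1), 0)"

definition word_matrix :: "heis_gen word \<Rightarrow> int \<times> int \<times> int" where
  "word_matrix w = foldr heis_mul (map letter_matrix w) (0, 0, 0)"

lemma heis_mul_assoc: "heis_mul (heis_mul p q) r = heis_mul p (heis_mul q r)"
  by (cases p; cases q; cases r) (simp add: algebra_simps)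

lemma heis_mul_zero: "heis_mul (0, 0, 0) p = p" "heis_mul p (0, 0, 0) = p"
  by (cases p; simp)+

lemma word_matrix_append: "word_matrix (u @ v) = heis_mul (word_matrix u) (word_matrix v)"
  by (induction u) (simp_all add: word_matrix_def heis_mul_assoc heis_mul_zero)

lemma letter_matrix_cancel: "heis_mul (letter_matrix (h, e)) (letter_matrix (h, \<not> e)) = (0, 0, 0)"
  by (cases h) auto

lemma word_matrix_cancel: "word_matrix [(h, e), (h, \<not> e)] = (0, 0, 0)"
  using letter_matrix_cancel[of h e] by (simp add: word_matrix_def heis_mul_zero)

lemma word_matrix_inv: "heis_mul (word_matrix w) (word_matrix (inv_word w)) = (0, 0, 0)"
proof (induction w)
  case Nil
  show ?case by (simp add: word_matrix_def inv_word_def)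
next
  case (Cons l w)
  obtain h e where l: "l = (h, e)" by (cases l)
  have "word_matrix (l # w) = heis_mul (letter_matrix l) (word_matrix w)"
    by (simp add: word_matrix_def)
  moreover have "word_matrix (inv_word (l # w)) = heis_mul (word_matrix (inv_word w)) (letter_matrix (h, \<not> e))"
    by (simp add: l inv_word_def word_matrix_append) (simp add: word_matrix_def heis_mul_zero)
  ultimately have "heis_mul (word_matrix (l # w)) (word_matrix (inv_word (l # w))) =
      heis_mul (letter_matrix l) (heis_mul (heis_mul (word_matrix w) (word_matrix (inv_word w)))
        (letter_matrix (h, \<not> e)))"
    by (simp only: heis_mul_assoc)
  also have "\<dots> = (0, 0, 0)"
    by (simp only: Cons.IH heis_mul_zero l letter_matrix_cancel)
  finally show ?case .
qed

lemma word_matrix_z: "word_matrix heis_z_word = (0, 0, 1)"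
  by (simp add: heis_z_word_def comm_word_def inv_word_def word_matrix_def)

lemma word_matrix_relator:
  assumes "r \<in> heis_relators"
  shows "word_matrix r = (0, 0, 0)"
proof -
  obtain w where r: "r = comm_word heis_z_word w" using assms by (auto simp: heis_relators_def)
  obtain a b c where w: "word_matrix w = (a, b, c)" by (cases "word_matrix w") auto
  have "word_matrix r = heis_mul (heis_mul (0, 0, 1) (word_matrix w))
      (heis_mul (word_matrix (inv_word heis_z_word)) (word_matrix (inv_word w)))"
    by (simp add: r comm_word_def word_matrix_append word_matrix_z heis_mul_assoc)
  also have "heis_mul (0, 0, 1) (word_matrix w) = heis_mul (word_matrix w) (word_matrix heis_z_word)"
    by (simp add: w word_matrix_z)
  finally have "word_matrix r = heis_mul (word_matrix w)
      (heis_mul (heis_mul (word_matrix heis_z_word) (word_matrix (inv_word heis_z_word))) (word_matrix (inv_word w)))"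
    by (simp only: heis_mul_assoc)
  then show ?thesis by (simp only: word_matrix_inv heis_mul_zero)
qed

lemma word_matrix_cong: "pres_eq heis_relators u v \<Longrightarrow> word_matrix u = word_matrix v"
proof (induction rule: pres_eq.induct)
  case (cancel u g b v)
  then show ?case
    unfolding word_matrix_append[of u] word_matrix_append[of _ v] word_matrix_cancel by (simp add: heis_mul_zero)
next
  case (relator r u v)
  then show ?case
    by (simp add: word_matrix_append word_matrix_relator heis_mul_zero)
qed auto

text \<open>
  The corner entry of the matrix; on the center it is the exponent of \<open>heis_z\<close>. Any
  representative word gives the same value, by \<open>word_matrix_cong\<close>.
\<close>

definition heis_height :: "heis_gen word set \<Rightarrow> int" where
  "heis_height g = snd (snd (word_matrix (SOME w. w \<in> g)))"

lemma word_matrix_some: "word_matrix (SOME v. v \<in> word_class heis_relators w) = word_matrix w"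
proof -
  have "w \<in> word_class heis_relators w"
    by (simp add: word_class_def pres_rel_def pres_eq.refl)
  then have "(SOME v. v \<in> word_class heis_relators w) \<in> word_class heis_relators w"
    by (rule someI)
  then show ?thesis
    by (simp add: word_class_def pres_rel_def word_matrix_cong)
qed

lemma word_matrix_z_pow:
  "\<exists>w. heis_z [^]\<^bsub>H3\<^esub> (n::nat) = word_class heis_relators w \<and> word_matrix w = (0, 0, int n)"
proof (induction n)
  case 0
  show ?case by (intro exI[of _ "[]"]) (simp add: H3_one word_matrix_def)
next
  case (Suc n)
  then obtain w where "heis_z [^]\<^bsub>H3\<^esub> n = word_class heis_relators w" "word_matrix w = (0, 0, int n)"
    by blast
  then show ?case
    by (intro exI[of _ "w @ heis_z_word"])
      (simp add: heis_z_def H3_mult_classes word_matrix_append word_matrix_z)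
qed

lemma heis_height_z_pow: "heis_height (heis_z [^]\<^bsub>H3\<^esub> (k::int)) = k"
proof (cases k rule: int_cases2)
  case (nonneg n)
  then show ?thesis
    using word_matrix_z_pow[of n]
    by (auto simp: heis_height_def word_matrix_some int_pow_int)
next
  case (nonpos n)
  obtain w where w: "heis_z [^]\<^bsub>H3\<^esub> n = word_class heis_relators w" "word_matrix w = (0, 0, int n)"
    using word_matrix_z_pow by blast
  have "heis_z [^]\<^bsub>H3\<^esub> k = word_class heis_relators (inv_word w)"
    using w(1) nonpos by (simp add: H3.int_pow_neg int_pow_int H3_inv_class)
  moreover have "snd (snd (word_matrix (inv_word w))) = - int n"
    using word_matrix_inv[of w] w(2) by (cases "word_matrix (inv_word w)") auto
  ultimately show ?thesis using nonpos by (simp add: heis_height_def word_matrix_some)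
qed

lemma heis_height_mult:
  "g \<in> heis_Z \<Longrightarrow> h \<in> heis_Z \<Longrightarrow> heis_height (g \<otimes>\<^bsub>H3\<^esub> h) = heis_height g + heis_height h"
  by (auto simp: heis_Z_eq H3.int_pow_mult[OF heis_z_closed, symmetric] heis_height_z_pow)

lemma heis_height_inv: "g \<in> heis_Z \<Longrightarrow> heis_height (inv\<^bsub>H3\<^esub> g) = - heis_height g"
  by (auto simp: heis_Z_eq H3.int_pow_neg[OF heis_z_closed, symmetric] heis_height_z_pow)

lemma heis_height_one: "heis_height \<one>\<^bsub>H3\<^esub> = 0"
  using heis_height_z_pow[of 0] by simp


section \<open>The amalgamated product\<close>

\<comment> \<open>Keeps the index set \<open>{1..m}\<close> in this form under simplification.\<close>
declare One_nat_def [simp del]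

lemma iota_closed [simp]: "c \<in> carrier H3 \<Longrightarrow> heis_iota m i c \<in> carrier (H3_power m)"
  by (auto simp: heis_iota_def PiE_iff)

lemma iota_hom: "heis_iota m i \<in> hom H3 (H3_power m)"
  by (rule homI) (auto simp: heis_iota_def PiE_iff fun_eq_iff)

text \<open>
  An element of the power is the product of its coordinates, each placed in its own factor.
\<close>

lemma H3_power_induct:
  assumes f: "f \<in> (\<Pi>\<^sub>E i\<in>{1..m}. A i)" and A: "\<And>i. i \<in> {1..m} \<Longrightarrow> A i \<subseteq> carrier H3"
    and one: "Q \<one>\<^bsub>H3_power m\<^esub>"
    and mult: "\<And>i a g. i \<in> {1..m} \<Longrightarrow> a \<in> A i \<Longrightarrow> g \<in> carrier (H3_power m) \<Longrightarrow> Q g \<Longrightarrow>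
      Q (heis_iota m i a \<otimes>\<^bsub>H3_power m\<^esub> g)"
  shows "Q f"
proof -
  define part where "part J = (\<lambda>k\<in>{1..m}. if k \<in> J then f k else \<one>\<^bsub>H3\<^esub>)" for J
  have fA: "f k \<in> A k" "f k \<in> carrier H3" if "k \<in> {1..m}" for k
    using PiE_mem[OF f that] A[OF that] by auto
  have closed: "part J \<in> carrier (H3_power m)" for J
    using fA by (auto simp: part_def)
  have "Q (part J)" if "finite J" "J \<subseteq> {1..m}" for J
    using that
  proof (induction J rule: finite_induct)
    case empty
    then show ?case using one by (simp add: part_def restrict_def)
  next
    case (insert i J)
    have "part (insert i J) = heis_iota m i (f i) \<otimes>\<^bsub>H3_power m\<^esub> part J"
      using insert fA by (auto simp: part_def heis_iota_def fun_eq_iff)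
    moreover have "Q (heis_iota m i (f i) \<otimes>\<^bsub>H3_power m\<^esub> part J)"
      using insert by (intro mult fA closed) auto
    ultimately show ?case by (simp only:)
  qed
  then have "Q (part {1..m})" by simp
  moreover have "part {1..m} = f"
    using PiE_arb[OF f] by (auto simp: part_def fun_eq_iff)
  ultimately show ?thesis by simp
qed

lemma subgroup_heis_Z: "subgroup heis_Z H3"
  unfolding heis_Z_def by (rule H3.generate_is_subgroup) simp

definition total_height :: "nat \<Rightarrow> (nat \<Rightarrow> heis_gen word set) \<Rightarrow> int" where
  "total_height m f = (\<Sum>i=1..m. heis_height (f i))"

lemma total_height_iota:
  "i \<in> {1..m} \<Longrightarrow> total_height m (heis_iota m i c) = heis_height c"
proof -
  assume i: "i \<in> {1..m}"
  have "total_height m (heis_iota m i c) = (\<Sum>k=1..m. if k = i then heis_height c else 0)"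
    unfolding total_height_def by (rule sum.cong) (auto simp: heis_iota_def heis_height_one)
  then show ?thesis using i by simp
qed

text \<open>
  The total height is additive on the product of the centers and vanishes on the generators of the
  amalgamation, which therefore does not collapse the common center.
\<close>

lemma total_height_amalg:
  assumes "f \<in> amalg_subgroup m"
  shows "total_height m f = 0"
proof -
  interpret P: group "H3_power m" by (rule group_H3_power)
  let ?V = "\<Pi>\<^sub>E i\<in>{1..m}. heis_Z"
  have sub: "subgroup ?V (H3_power m)"
    using PiE_subgroup_product_group[of "{1..m}" "\<lambda>_. H3" "\<lambda>_. heis_Z"] subgroup_heis_Z group_H3 by simp
  have V_carrier: "?V \<subseteq> carrier (H3_power m)" using subgroup.subset[OF sub] .
  have V_mult: "total_height m (f \<otimes>\<^bsub>H3_power m\<^esub> g) = total_height m f + total_height m g"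
    if "f \<in> ?V" "g \<in> ?V" for f g
    using that by (auto simp: total_height_def heis_height_mult sum.distrib[symmetric] PiE_iff intro!: sum.cong)
  have V_inv: "total_height m (inv\<^bsub>H3_power m\<^esub> f) = - total_height m f" if "f \<in> ?V" for f
  proof -
    have "f \<in> carrier (H3_power m)" using that V_carrier by blast
    then show ?thesis
      using that by (auto simp: total_height_def heis_height_inv sum_negf[symmetric] PiE_iff group_H3 intro!: sum.cong)
  qed
  have iota_V: "heis_iota m i c \<in> ?V" if "c \<in> heis_Z" for i c
    using that subgroup.one_closed[OF subgroup_heis_Z] by (auto simp: heis_iota_def)
  let ?W = "{f \<in> ?V. total_height m f = 0}"
  have "subgroup ?W (H3_power m)"
  proof (rule P.subgroupI)
    show "?W \<subseteq> carrier (H3_power m)" using V_carrier by blast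
    have "\<one>\<^bsub>H3_power m\<^esub> \<in> ?W"
      using subgroup.one_closed[OF sub] by (simp add: total_height_def heis_height_one)
    then show "?W \<noteq> {}" by blast
    show "inv\<^bsub>H3_power m\<^esub> f \<in> ?W" if "f \<in> ?W" for f
      using that V_inv subgroup.m_inv_closed[OF sub] by simp
    show "f \<otimes>\<^bsub>H3_power m\<^esub> g \<in> ?W" if "f \<in> ?W" "g \<in> ?W" for f g
      using that V_mult subgroup.m_closed[OF sub] by simp
  qed
  moreover have "heis_iota m i c \<otimes>\<^bsub>H3_power m\<^esub> inv\<^bsub>H3_power m\<^esub> heis_iota m j c \<in> ?W"
    if "i \<in> {1..m}" "j \<in> {1..m}" "c \<in> heis_Z" for i j c
    using that V_mult V_inv iota_V total_height_iota
      subgroup.m_closed[OF sub] subgroup.m_inv_closed[OF sub] by simp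
  ultimately have "amalg_subgroup m \<subseteq> ?W"
    unfolding amalg_subgroup_def by (intro P.generate_subgroup_incl) blast+
  then show ?thesis using assms by blast
qed

lemma proj_hom: "heis_proj m \<in> hom (H3_power m) (heisenberg m)"
  using normal.r_coset_hom_Mod[OF amalg_subgroup_normal, of m]
  by (simp add: heisenberg_def heis_proj_def[abs_def])

lemma proj_surj: "heis_proj m ` carrier (H3_power m) = carrier (heisenberg m)"
  by (auto simp: heisenberg_def heis_proj_def FactGroup_def RCOSETS_def)

locale heisenberg_group =
  fixes m :: nat
  assumes m: "1 \<le> m"
begin

abbreviation "P \<equiv> H3_power m"
abbreviation "G \<equiv> heisenberg m"
abbreviation "proj \<equiv> heis_proj m"

declare carrier_product_group [simp del] mult_product_group [simp del]
  one_product_group [simp del] inv_product_group [simp del]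

sublocale P: group P by (rule group_H3_power)
sublocale G: group G by (rule group_heisenberg)
sublocale proj: group_hom P G proj
  by unfold_locales (rule proj_hom)
sublocale iota: group_hom H3 P "heis_iota m i" for i
  by unfold_locales (rule iota_hom)

definition z :: "(nat \<Rightarrow> heis_gen word set) set" where
  "z = proj (heis_iota m 1 heis_z)"

lemma one_le [simp]: "1 \<in> {1..m}" using m by simp

lemma z_closed [simp]: "z \<in> carrier G"
  by (simp add: z_def)

text \<open>
  All factors share the same center after amalgamation.
\<close>

lemma proj_iota_pow:
  assumes "i \<in> {1..m}"
  shows "proj (heis_iota m i (heis_z [^]\<^bsub>H3\<^esub> (k::int))) = z [^]\<^bsub>G\<^esub> k"
proof -
  let ?c = "heis_z [^]\<^bsub>H3\<^esub> k" and ?N = "amalg_subgroup m"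
  interpret N: normal ?N P by (rule amalg_subgroup_normal)
  have "heis_iota m i ?c \<otimes>\<^bsub>P\<^esub> inv\<^bsub>P\<^esub> heis_iota m 1 ?c \<in> ?N"
    unfolding amalg_subgroup_def
    by (rule generate.incl) (use assms one_le in \<open>blast intro: heis_Z_eq[THEN equalityD2, THEN subsetD]\<close>)
  then have "proj (heis_iota m i ?c) = proj (heis_iota m 1 ?c)"
    unfolding heis_proj_def
    by (metis N.rcos_module N.subgroup_axioms P.repr_independence iota_closed H3.int_pow_closed heis_z_closed P.is_group)
  also have "\<dots> = z [^]\<^bsub>G\<^esub> k"
    unfolding z_def
    by (simp add: proj.hom_int_pow iota.hom_int_pow)
  finally show ?thesis .
qed

lemma z_inj: "inj (\<lambda>n::nat. z [^]\<^bsub>G\<^esub> n)"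
proof (rule injI)
  fix i j :: nat
  assume eq: "z [^]\<^bsub>G\<^esub> i = z [^]\<^bsub>G\<^esub> j"
  let ?f = "heis_iota m 1 (heis_z [^]\<^bsub>H3\<^esub> (int i - int j))"
  have f: "?f \<in> carrier P" by simp
  have "proj ?f = z [^]\<^bsub>G\<^esub> (int i - int j)" using proj_iota_pow[OF one_le] .
  also have "\<dots> = \<one>\<^bsub>G\<^esub>" using eq by (simp add: G.int_pow_diff int_pow_int)
  finally have "amalg_subgroup m #>\<^bsub>P\<^esub> ?f = amalg_subgroup m"
    by (simp add: heis_proj_def heisenberg_def FactGroup_def)
  then have "?f \<in> amalg_subgroup m"
    using P.coset_join1[OF _ f] normal_imp_subgroup[OF amalg_subgroup_normal] by blast
  then have "heis_height (heis_z [^]\<^bsub>H3\<^esub> (int i - int j)) = 0"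
    using total_height_amalg total_height_iota[OF one_le] by metis
  then show "i = j" by (simp add: heis_height_z_pow)
qed

lemma z_central: "g \<in> carrier G \<Longrightarrow> z \<otimes>\<^bsub>G\<^esub> g = g \<otimes>\<^bsub>G\<^esub> z"
proof -
  assume "g \<in> carrier G"
  then obtain f where f: "f \<in> carrier P" "g = proj f" using proj_surj by blast
  have "heis_iota m 1 heis_z \<otimes>\<^bsub>P\<^esub> f = f \<otimes>\<^bsub>P\<^esub> heis_iota m 1 heis_z"
    using f(1) heis_z_commutes
    by (auto simp: heis_iota_def PiE_iff fun_eq_iff carrier_product_group mult_product_group)
  then have "proj (heis_iota m 1 heis_z \<otimes>\<^bsub>P\<^esub> f) = proj (f \<otimes>\<^bsub>P\<^esub> heis_iota m 1 heis_z)" by simp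
  then show ?thesis using f
    by (simp add: z_def)
qed

lemma central_pow:
  assumes "f \<in> (\<Pi>\<^sub>E i\<in>{1..m}. heis_Z)"
  shows "\<exists>k::int. proj f = z [^]\<^bsub>G\<^esub> k"
proof (rule H3_power_induct[OF assms])
  show "heis_Z \<subseteq> carrier H3" by (rule heis_Z_subset)
  show "\<exists>k::int. proj \<one>\<^bsub>P\<^esub> = z [^]\<^bsub>G\<^esub> k"
    by (rule exI[of _ 0]) (simp)
next
  fix i a g
  assume i: "i \<in> {1..m}" and a: "a \<in> heis_Z" and g: "g \<in> carrier P" "\<exists>k::int. proj g = z [^]\<^bsub>G\<^esub> k"
  then obtain j k :: int where "proj g = z [^]\<^bsub>G\<^esub> k" "a = heis_z [^]\<^bsub>H3\<^esub> j"
    by (auto simp: heis_Z_eq)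
  then have "proj (heis_iota m i a \<otimes>\<^bsub>P\<^esub> g) = z [^]\<^bsub>G\<^esub> (j + k)"
    using g(1) proj_iota_pow[OF i]
    by (simp add: G.int_pow_mult)
  then show "\<exists>k::int. proj (heis_iota m i a \<otimes>\<^bsub>P\<^esub> g) = z [^]\<^bsub>G\<^esub> k" by blast
qed

text \<open>
  If all coordinates are central, then \<open>c = z^k = [x, y^k]\<close> with \<open>x\<close>, \<open>y\<close> in the first
  factor. Otherwise an element of the factor of a noncentral coordinate has a nontrivial commutator
  with \<open>c\<close>.
\<close>

lemma central_or_twisted:
  assumes c: "c \<in> carrier G"
  shows "(\<exists>x\<in>carrier G. \<exists>y\<in>carrier G. x \<otimes>\<^bsub>G\<^esub> y = c \<otimes>\<^bsub>G\<^esub> (y \<otimes>\<^bsub>G\<^esub> x) \<and>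
        c \<otimes>\<^bsub>G\<^esub> x = x \<otimes>\<^bsub>G\<^esub> c \<and> c \<otimes>\<^bsub>G\<^esub> y = y \<otimes>\<^bsub>G\<^esub> c) \<or>
      (\<exists>y\<in>carrier G. \<exists>d::nat. 0 < d \<and> c \<otimes>\<^bsub>G\<^esub> y = z [^]\<^bsub>G\<^esub> d \<otimes>\<^bsub>G\<^esub> (y \<otimes>\<^bsub>G\<^esub> c))"
proof -
  obtain f where f: "f \<in> carrier P" "c = proj f" using c proj_surj by blast
  show ?thesis
  proof (cases "f \<in> (\<Pi>\<^sub>E i\<in>{1..m}. heis_Z)")
    case True
    then obtain k :: int where k: "c = z [^]\<^bsub>G\<^esub> k" using central_pow f by blast
    let ?x = "proj (heis_iota m 1 heis_x)" and ?y = "proj (heis_iota m 1 heis_y)"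
    have xy_closed: "?x \<in> carrier G" "?y \<in> carrier G" by simp_all
    have "?x \<otimes>\<^bsub>G\<^esub> ?y = proj (heis_iota m 1 (heis_x \<otimes>\<^bsub>H3\<^esub> heis_y))"
      by simp
    also have "\<dots> = z \<otimes>\<^bsub>G\<^esub> (?y \<otimes>\<^bsub>G\<^esub> ?x)"
      by (simp add: heis_xy z_def)
    finally have "?x \<otimes>\<^bsub>G\<^esub> ?y [^]\<^bsub>G\<^esub> k = c \<otimes>\<^bsub>G\<^esub> (?y [^]\<^bsub>G\<^esub> k \<otimes>\<^bsub>G\<^esub> ?x)"
      unfolding k by (intro G.twisted_pow_right z_central xy_closed z_closed)
    moreover have "c \<otimes>\<^bsub>G\<^esub> g = g \<otimes>\<^bsub>G\<^esub> c" if "g \<in> carrier G" for g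
      using G.twisted_pow_left[of z g "\<one>\<^bsub>G\<^esub>" k] that z_central k by simp
    ultimately show ?thesis using xy_closed by blast
  next
    case False
    then obtain i where i: "i \<in> {1..m}" "f i \<notin> heis_Z" "f i \<in> carrier H3"
      using f(1) by (auto simp: PiE_iff carrier_product_group)
    then obtain y d where y: "y \<in> carrier H3" "d \<noteq> (0::int)"
      "f i \<otimes>\<^bsub>H3\<^esub> y = heis_z [^]\<^bsub>H3\<^esub> d \<otimes>\<^bsub>H3\<^esub> (y \<otimes>\<^bsub>H3\<^esub> f i)"
      using heis_noncentral by blast
    have "f \<otimes>\<^bsub>P\<^esub> heis_iota m i y =
        heis_iota m i (heis_z [^]\<^bsub>H3\<^esub> d) \<otimes>\<^bsub>P\<^esub> (heis_iota m i y \<otimes>\<^bsub>P\<^esub> f)"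
      using f(1) y
      by (auto simp: heis_iota_def PiE_iff fun_eq_iff carrier_product_group mult_product_group)
    then have "proj (f \<otimes>\<^bsub>P\<^esub> heis_iota m i y) =
        proj (heis_iota m i (heis_z [^]\<^bsub>H3\<^esub> d) \<otimes>\<^bsub>P\<^esub> (heis_iota m i y \<otimes>\<^bsub>P\<^esub> f))" by simp
    then have "c \<otimes>\<^bsub>G\<^esub> proj (heis_iota m i y) =
        z [^]\<^bsub>G\<^esub> d \<otimes>\<^bsub>G\<^esub> (proj (heis_iota m i y) \<otimes>\<^bsub>G\<^esub> c)"
      using f y(1) by (simp add: proj_iota_pow[OF i(1)])
    moreover have "proj (heis_iota m i y) \<in> carrier G"
      using y(1) by simp
    ultimately show ?thesis
      using G.twisted_nat_exponent[OF c _ z_closed _ z_central y(2)] by blast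
  qed
qed

text \<open>
  Allowing the identity in each coordinate puts every generator of every single factor into the
  cubical set.
\<close>

lemma cubical_generates:
  assumes "cubical_like_generating_set m S"
  shows "finite_symmetric_generating_set G S"
proof -
  obtain T where T: "\<And>i. i \<in> {1..m} \<Longrightarrow> finite_symmetric_generating_set H3 (T i)"
    and S: "S = proj ` (\<Pi>\<^sub>E i\<in>{1..m}. T i \<union> {\<one>\<^bsub>H3\<^esub>})"
    using assms unfolding cubical_like_generating_set_def by blast
  let ?C = "\<Pi>\<^sub>E i\<in>{1..m}. T i \<union> {\<one>\<^bsub>H3\<^esub>}"
  have Tfin: "finite (T i)" and Tsub: "T i \<subseteq> carrier H3" and Tinv: "\<And>t. t \<in> T i \<Longrightarrow> inv\<^bsub>H3\<^esub> t \<in> T i"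
    and Tgen: "generate H3 (T i) = carrier H3" if "i \<in> {1..m}" for i
    using T[OF that] by (auto simp: finite_symmetric_generating_set_def)
  have C: "?C \<subseteq> carrier P"
    unfolding carrier_product_group by (rule PiE_mono) (simp add: Tsub)
  have in_S: "proj f \<in> S" if "f \<in> ?C" for f
    unfolding S using that by (rule imageI)
  have S_sub: "S \<subseteq> carrier G"
    unfolding S proj_surj[of m, symmetric] by (rule image_mono[OF C])
  have inv: "inv\<^bsub>G\<^esub> s \<in> S" if s: "s \<in> S" for s
  proof -
    obtain f where f: "s = proj f" "f \<in> ?C" using s unfolding S by (rule imageE)
    then have fP: "f \<in> carrier P" using C by blast
    then have "inv\<^bsub>G\<^esub> s = proj (inv\<^bsub>P\<^esub> f)" using f by simp
    moreover have "inv\<^bsub>P\<^esub> f \<in> ?C"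
      using f(2) fP Tinv
      by (auto simp: PiE_iff group_H3 carrier_product_group inv_product_group)
    ultimately show ?thesis using in_S by simp
  qed
  let ?U = "generate G S"
  have iota_U: "proj (heis_iota m i a) \<in> ?U" if i: "i \<in> {1..m}" and a: "a \<in> carrier H3" for i a
  proof -
    have "a \<in> generate H3 (T i)" using Tgen[OF i] a by simp
    then show ?thesis
    proof (induction rule: generate.induct)
      case one
      then show ?case by (simp add: generate.one iota.hom_one)
    next
      case (incl t)
      then have "heis_iota m i t \<in> ?C" by (auto simp: heis_iota_def)
      then show ?case by (intro generate.incl in_S)
    next
      case (inv t)
      then have "heis_iota m i (inv\<^bsub>H3\<^esub> t) \<in> ?C" using Tinv[OF i] by (auto simp: heis_iota_def)
      then show ?case by (intro generate.incl in_S)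
    next
      case (eng a b)
      then have "a \<in> carrier H3" "b \<in> carrier H3" using Tgen[OF i] by auto
      then show ?case using generate.eng[OF eng.IH]
        by simp
    qed
  qed
  have "proj f \<in> ?U" if "f \<in> (\<Pi>\<^sub>E i\<in>{1..m}. carrier H3)" for f
  proof (rule H3_power_induct[OF that])
    show "proj \<one>\<^bsub>P\<^esub> \<in> ?U" by (simp add: generate.one)
    show "proj (heis_iota m i a \<otimes>\<^bsub>P\<^esub> g) \<in> ?U"
      if "i \<in> {1..m}" "a \<in> carrier H3" "g \<in> carrier P" "proj g \<in> ?U" for i a g
      using that generate.eng[OF iota_U[OF that(1,2)] that(4)]
      by simp
  qed simp
  then have "carrier G \<subseteq> ?U"
    unfolding proj_surj[of m, symmetric] carrier_product_group by (rule image_subsetI)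
  then have "?U = carrier G" using G.generate_incl[OF S_sub] by blast
  moreover have "finite S" unfolding S by (intro finite_imageI finite_PiE) (auto simp: Tfin)
  ultimately show ?thesis
    using S_sub inv by (auto simp: finite_symmetric_generating_set_def)
qed

end

theorem mainTheorem5:
  fixes m :: nat and S :: "(nat \<Rightarrow> heis_gen word set) set set"
  assumes "1 \<le> m"
    and "cubical_like_generating_set m S"
  shows "\<not> gs_rational (heisenberg m) (complete_growth_series (heisenberg m) S)"
proof -
  interpret heisenberg_group m by unfold_locales (rule assms(1))
  interpret monoid_generated "heisenberg m" S
    by (rule monoid_generatedI[OF G.is_group cubical_generates[OF assms(2)]])
  show ?thesis
    by (rule not_gs_rational[OF z_closed z_central z_inj central_or_twisted])
qed

end
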